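(* For each positive integer $d$, let $\Delta_d$ denote the diameter of the $d$-dimensional cyclohedron. Then $$\lim_{d\rightarrow\infty}\frac{\Delta_d}{d}=\frac{5}{2}.$$
   Context: The diameter of a polytope is the diameter of its graph (vertices and edges of the polytope). The graph of the $d$-dimensional cyclohedron is described combinatorially (Simion) as follows, and this description may be taken as the definition. Let $\pi$ be a convex polygon with $2d+2$ vertices. An edge on $\pi$ is a set of two distinct vertices of $\pi$. For a vertex $x$, $\bar{x}$ denotes the opposite vertex (separated from $x$ by exactly $d$ vertices along the boundary on either side). A triangulation of $\pi$ is a maximal set of pairwise non-crossing edges on $\pi$; it contains all boundary edges, and its other edges are its interior edges. A triangulation $T$ is centrally symmetric when $\{x,y\}\in T$ implies $\{\bar{x},\bar{y}\}\in T$. The vertices of the graph are the centrally symmetric triangulations of $\pi$, and two of them are adjacent when they are related by a flip: given an interior edge $\{x,x'\}$ of $T$, let $y,y'$ be the other two vertices of the unique quadrilateral whose four boundary edges belong to $T$ and that has $\{x,x'\}$ as one of its diagonals; flipping $\{x,x'\}$ replaces $\{x,x'\}$ and $\{\bar{x},\bar{x}'\}$ by $\{y,y'\}$ and $\{\bar{y},\bar{y}'\}$. *)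

theory Defs
  imports Complex_Main "HOL-Library.Extended_Nat" "HOL-Library.Extended_Real"
begin

text \<open>
  The convex polygon with \<open>2 * d + 2\<close> vertices has its vertices labelled
  \<open>0, \<dots>, 2 * d + 1\<close> in their cyclic order along the boundary.
\<close>

definition polygon_edges :: "nat \<Rightarrow> nat set set" where
  "polygon_edges d = {{x, y} |x y. x < 2 * d + 2 \<and> y < 2 * d + 2 \<and> x \<noteq> y}"

definition boundary_edges :: "nat \<Rightarrow> nat set set" where
  "boundary_edges d = {{x, (x + 1) mod (2 * d + 2)} |x. x < 2 * d + 2}"

definition opposite :: "nat \<Rightarrow> nat \<Rightarrow> nat" where
  "opposite d x = (x + (d + 1)) mod (2 * d + 2)"

text \<open>
  Two chords of a convex polygon cross (in their relative interiors) iff their endpoints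
  are four distinct vertices that alternate along the boundary.
\<close>

definition crosses :: "nat set \<Rightarrow> nat set \<Rightarrow> bool" where
  "crosses e f \<longleftrightarrow> (\<exists>a b p q. a < p \<and> p < b \<and> b < q \<and>
     (e = {a, b} \<and> f = {p, q} \<or> e = {p, q} \<and> f = {a, b}))"

definition noncrossing_edges :: "nat \<Rightarrow> nat set set \<Rightarrow> bool" where
  "noncrossing_edges d T \<longleftrightarrow> T \<subseteq> polygon_edges d \<and> (\<forall>e\<in>T. \<forall>f\<in>T. \<not> crosses e f)"

definition triangulation :: "nat \<Rightarrow> nat set set \<Rightarrow> bool" where
  "triangulation d T \<longleftrightarrow> noncrossing_edges d T \<and>
     (\<forall>S. noncrossing_edges d S \<and> T \<subseteq> S \<longrightarrow> S = T)"

definition centrally_symmetric :: "nat \<Rightarrow> nat set set \<Rightarrow> bool" where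
  "centrally_symmetric d T \<longleftrightarrow>
     (\<forall>x y. {x, y} \<in> T \<longrightarrow> {opposite d x, opposite d y} \<in> T)"

definition cyclohedron_vertices :: "nat \<Rightarrow> nat set set set" where
  "cyclohedron_vertices d = {T. triangulation d T \<and> centrally_symmetric d T}"

text \<open>
  The condition \<open>crosses {x, x'} {y, y'}\<close> says that \<open>x, y, x', y'\<close> is the cyclic order of the
  vertices of a quadrilateral with diagonal \<open>{x, x'}\<close>; such \<open>y, y'\<close> are unique up to order.
  If \<open>x' = opposite d x\<close> then \<open>y' = opposite d y\<close>, and a single edge is exchanged.
\<close>

definition flip :: "nat \<Rightarrow> nat set set \<Rightarrow> nat set set \<Rightarrow> bool" where
  "flip d T U \<longleftrightarrow> (\<exists>x x' y y'.
     {x, x'} \<in> T \<and> {x, x'} \<notin> boundary_edges d \<and>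
     {x, y} \<in> T \<and> {y, x'} \<in> T \<and> {x', y'} \<in> T \<and> {y', x} \<in> T \<and>
     crosses {x, x'} {y, y'} \<and>
     U = (T - {{x, x'}, {opposite d x, opposite d x'}})
           \<union> {{y, y'}, {opposite d y, opposite d y'}})"

definition cyclohedron_graph :: "nat \<Rightarrow> (nat set set \<times> nat set set) set" where
  "cyclohedron_graph d =
     {(T, U). T \<in> cyclohedron_vertices d \<and> U \<in> cyclohedron_vertices d \<and> flip d T U}"

text \<open>
  Distance and diameter take values in \<^typ>\<open>enat\<close>: vertices not joined by any path are at
  distance \<open>\<infinity>\<close>.
\<close>

definition graph_dist :: "('a \<times> 'a) set \<Rightarrow> 'a \<Rightarrow> 'a \<Rightarrow> enat" where
  "graph_dist E u v = (INF n \<in> {n. (u, v) \<in> E ^^ n}. enat n)"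

definition graph_diameter :: "'a set \<Rightarrow> ('a \<times> 'a) set \<Rightarrow> enat" where
  "graph_diameter V E = (SUP u \<in> V. SUP v \<in> V. graph_dist E u v)"

definition cyclohedron_diameter :: "nat \<Rightarrow> enat" where
  "cyclohedron_diameter d = graph_diameter (cyclohedron_vertices d) (cyclohedron_graph d)"

end

(*
  Cutting a centrally symmetric triangulation along its unique diameter leaves two congruent
  triangulated (d+2)-gons, that is, a binary tree t with N = d + 1 leaves, together with the
  position c of the diameter.  A flip is then either a rotation of t or, when the diameter is
  flipped, the move (c, Node l r) -> (c + leaves l, Node r l).

  Upper bound: N flips turn a triangulation into a cone on each side of a prescribed diameter
  that has been flipped to any wanted place; choosing the same apex for two triangulations
  leaves a fan that can be slid along an arc of length at most N/2.

  Lower bound: to every triangle of the triangulation a weight is attached, depending only on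
  the positions of its vertices, with a correction for the two triangles next to the diameter.
  The sum changes by at most 2 in every flip.  For two zigzag triangulations at suitable angles
  it differs by 5 N - O(sqrt N), because all but O(sqrt N) of the pairs of triangles between
  consecutive zigzag levels have weight -5 in one and +5 in the other.  The weights come from
  the dual of the linear program that bounds the distance.
*)

theory Submission
  imports Defs "HOL-Real_Asymp.Real_Asymp"
begin

section \<open>Binary trees as triangulations of half of the polygon\<close>

text \<open>Why both bounds meet at 5/2: the cones and the slide cost N + N + N/2. In the other
  direction each zigzag has about N/2 levels of two triangles; a level counts -5 in one and 5 in the
  other, so the potentials differ by about 10 * N/2, and a flip recovers at most 2. The second
  zigzag starts at c with N = 2c + M + 1, so the diameters are nearly N/2 apart, as in the worst
  case of the slide. Cells make the weights checkable: a weight depends only on block parity and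
  block differences, on comparisons of cells (order, equality, adjacency) and of offsets, so the
  local inequalities are a finite check, uniform in N. The price is paid at cell borders (order N/M
  levels) and for a mismatch of one cell in the second zigzag (order M levels); M of order sqrt N
  balances both. The pair (c, t) is determined by the triangulation only up to c modulo N. Hence the
  potential must be invariant under half turns, and the pair must be recoverable from the edge set
  up to that shift.\<close>

datatype tree = Leaf | Node tree tree

fun leaves :: "tree \<Rightarrow> nat" where
  "leaves Leaf = 1"
| "leaves (Node l r) = leaves l + leaves r"

lemma leaves_pos [simp]: "0 < leaves t"
  by (induction t) auto

lemma leaves_nonzero [simp]: "leaves t \<noteq> 0"
  using leaves_pos[of t] by linarith

fun edges :: "nat \<Rightarrow> tree \<Rightarrow> (nat \<times> nat) set" where
  "edges i Leaf = {(i, i + 1)}"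
| "edges i (Node l r) = {(i, i + leaves l + leaves r)} \<union> edges i l \<union> edges (i + leaves l) r"

inductive rot :: "tree \<Rightarrow> tree \<Rightarrow> bool" where
  right: "rot (Node (Node a b) c) (Node a (Node b c))"
| left: "rot (Node a (Node b c)) (Node (Node a b) c)"
| in_left: "rot l l' \<Longrightarrow> rot (Node l r) (Node l' r)"
| in_right: "rot r r' \<Longrightarrow> rot (Node l r) (Node l r')"

lemma rot_leaves: "rot s t \<Longrightarrow> leaves t = leaves s"
  by (induction rule: rot.induct) auto

lemma rot_sym: "rot s t \<Longrightarrow> rot t s"
  by (induction rule: rot.induct) (auto intro: rot.intros)

section \<open>The edges of a tree as a maximal noncrossing family on an arc\<close>

lemma edges_bounds: "(p, q) \<in> edges i t \<Longrightarrow> i \<le> p \<and> p < q \<and> q \<le> i + leaves t"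
  by (induction t arbitrary: i) fastforce+

lemma root_edge: "(i, i + leaves t) \<in> edges i t"
  by (cases t) auto

lemma edges_shift: "edges (i + k) t = (\<lambda>(p, q). (p + k, q + k)) ` edges i t"
proof (induction t arbitrary: i)
  case Leaf
  then show ?case by simp
next
  case (Node l r)
  have "edges (i + k + leaves l) r = (\<lambda>(p, q). (p + k, q + k)) ` edges (i + leaves l) r"
    using Node.IH(2)[of "i + leaves l"] by (simp add: add.commute add.left_commute)
  then show ?case using Node.IH(1)[of i] by (simp add: image_Un) (simp add: ac_simps)
qed

lemma edges_noncrossing:
  assumes "(p, q) \<in> edges i t" "(r, s) \<in> edges i t"
  shows "\<not> (p < r \<and> r < q \<and> q < s)"
  using assms
proof (induction t arbitrary: i)
  case Leaf
  then show ?case by auto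
next
  case (Node a b)
  show ?case
  proof
    assume x: "p < r \<and> r < q \<and> q < s"
    from Node.prems consider
        "(p, q) \<in> edges i a" "(r, s) \<in> edges i a"
      | "(p, q) \<in> edges (i + leaves a) b" "(r, s) \<in> edges (i + leaves a) b"
      | "(p, q) \<in> edges i a" "(r, s) \<in> edges (i + leaves a) b"
      | "(p, q) \<in> edges (i + leaves a) b" "(r, s) \<in> edges i a"
      | "(p, q) = (i, i + leaves a + leaves b)"
      | "(r, s) = (i, i + leaves a + leaves b)"
      by auto
    then show False
    proof cases
      case 1 then show False using Node.IH(1) x by blast
    next
      case 2 then show False using Node.IH(2) x by blast
    next
      case 3 then show False using edges_bounds[OF 3(1)] edges_bounds[OF 3(2)] x by linarith
    next
      case 4 then show False using edges_bounds[OF 4(1)] edges_bounds[OF 4(2)] x by linarith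
    next
      case 5 then show False using edges_bounds[OF Node.prems(2)] x by auto
    next
      case 6 then show False using edges_bounds[OF Node.prems(1)] x by auto
    qed
  qed
qed

text \<open>A missing edge on one side of the root apex is handled by induction. One that straddles
  the apex crosses a side of the root triangle, unless it is the root edge itself.\<close>

lemma edges_maximal:
  assumes "i \<le> u" "u < v" "v \<le> i + leaves t" "(u, v) \<notin> edges i t"
  shows "\<exists>p q. (p, q) \<in> edges i t \<and> (p < u \<and> u < q \<and> q < v \<or> u < p \<and> p < v \<and> v < q)"
  using assms
proof (induction t arbitrary: i)
  case Leaf
  then show ?case by auto
next
  case (Node a b)
  let ?m = "i + leaves a"
  have roots: "(i, ?m) \<in> edges i a" "(?m, ?m + leaves b) \<in> edges ?m b"
    by (rule root_edge)+
  consider "v \<le> ?m" | "?m \<le> u" | "u < ?m" "?m < v" by linarith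
  then show ?case
  proof cases
    case 1
    then show ?thesis using Node.IH(1)[of i] Node.prems by auto
  next
    case 2
    then show ?thesis using Node.IH(2)[of ?m] Node.prems by auto
  next
    case 3
    show ?thesis
    proof (cases "u = i")
      case True
      then have "v < ?m + leaves b" using Node.prems by auto
      then show ?thesis using 3 roots(2) by auto
    next
      case False
      then have "i < u" using Node.prems by simp
      then show ?thesis using 3 roots(1) by auto
    qed
  qed
qed

text \<open>A quadrilateral with diagonals \<open>(p, q)\<close> and \<open>{m, k}\<close>, where \<open>m\<close> is the apex below
  \<open>(p, q)\<close> and \<open>k\<close> the apex above it.\<close>

definition switch :: "(nat \<times> nat) set \<Rightarrow> (nat \<times> nat) set \<Rightarrow> nat \<Rightarrow> nat \<Rightarrow> nat \<Rightarrow> nat \<Rightarrow> bool" where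
  "switch E E' p q m k \<longleftrightarrow> p < m \<and> m < q \<and> (p, q) \<in> E \<and> (p, m) \<in> E \<and> (m, q) \<in> E \<and>
     (q < k \<and> (p, k) \<in> E \<and> (q, k) \<in> E \<and> E' = E - {(p, q)} \<union> {(m, k)} \<or>
      k < p \<and> (k, p) \<in> E \<and> (k, q) \<in> E \<and> E' = E - {(p, q)} \<union> {(k, m)})"

section \<open>Rotations as exchanges of diagonals\<close>

lemma switch_union:
  assumes "switch E E' p q m k" "(p, q) \<notin> F"
  shows "switch (E \<union> F) (E' \<union> F) p q m k"
  using assms unfolding switch_def by blast

lemma not_in_disjoint_edges:
  assumes "(p, q) \<in> edges i a" 
  shows "(p, q) \<notin> edges (i + leaves a) b" "(p, q) \<noteq> (i, i + leaves a + leaves b)"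
  using edges_bounds[OF assms] edges_bounds[of p q "i + leaves a" b] 
  by auto

lemma not_in_disjoint_edges':
  assumes "(p, q) \<in> edges (i + leaves a) b" 
  shows "(p, q) \<notin> edges i a" "(p, q) \<noteq> (i, i + leaves a + leaves b)"
  using not_in_disjoint_edges(1)[of p q i a b] edges_bounds[OF assms] assms by auto

lemma switch_right:
  "switch (edges i (Node (Node a b) c)) (edges i (Node a (Node b c)))
     i (i + leaves a + leaves b) (i + leaves a) (i + leaves a + leaves b + leaves c)"
proof -
  let ?m = "i + leaves a" and ?q = "i + leaves a + leaves b" and ?k = "i + leaves a + leaves b + leaves c"
  have n: "(i, ?q) \<notin> edges i a" "(i, ?q) \<notin> edges ?m b" "(i, ?q) \<notin> edges ?q c"
    using edges_bounds[of i ?q i a] edges_bounds[of i ?q ?m b] edges_bounds[of i ?q ?q c] by auto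
  have r: "(i, ?m) \<in> edges i a" "(?m, ?q) \<in> edges ?m b" "(?q, ?k) \<in> edges ?q c"
    using root_edge by auto
  have "edges i (Node (Node a b) c) = {(i, ?k), (i, ?q)} \<union> edges i a \<union> edges ?m b \<union> edges ?q c"
    by (auto simp: add.assoc)
  moreover have "edges i (Node a (Node b c)) = {(i, ?k), (?m, ?k)} \<union> edges i a \<union> edges ?m b \<union> edges ?q c"
    by (auto simp: add.assoc)
  moreover have "i < ?m" "?m < ?q" "?q < ?k" by auto
  ultimately show ?thesis using n r unfolding switch_def by auto
qed

lemma switch_left:
  "switch (edges i (Node a (Node b c))) (edges i (Node (Node a b) c))
     (i + leaves a) (i + leaves a + leaves b + leaves c) (i + leaves a + leaves b) i"
proof -
  let ?m = "i + leaves a" and ?q = "i + leaves a + leaves b" and ?k = "i + leaves a + leaves b + leaves c"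
  have n: "(?m, ?k) \<notin> edges i a" "(?m, ?k) \<notin> edges ?m b" "(?m, ?k) \<notin> edges ?q c"
    using edges_bounds[of ?m ?k i a] edges_bounds[of ?m ?k ?m b] edges_bounds[of ?m ?k ?q c] by auto
  have r: "(i, ?m) \<in> edges i a" "(?m, ?q) \<in> edges ?m b" "(?q, ?k) \<in> edges ?q c"
    using root_edge by auto
  have "edges i (Node (Node a b) c) = {(i, ?k), (i, ?q)} \<union> edges i a \<union> edges ?m b \<union> edges ?q c"
    by (auto simp: add.assoc)
  moreover have "edges i (Node a (Node b c)) = {(i, ?k), (?m, ?k)} \<union> edges i a \<union> edges ?m b \<union> edges ?q c"
    by (auto simp: add.assoc)
  moreover have "i < ?m" "?m < ?q" "?q < ?k" by auto
  ultimately show ?thesis using n r unfolding switch_def by auto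
qed

lemma switch_in_left:
  assumes "switch (edges i l) (edges i l') p q m k" "leaves l' = leaves l"
  shows "switch (edges i (Node l r)) (edges i (Node l' r)) p q m k"
proof -
  have "(p, q) \<in> edges i l" using assms by (simp add: switch_def)
  then have "(p, q) \<notin> edges (i + leaves l) r \<union> {(i, i + leaves l + leaves r)}"
    using not_in_disjoint_edges by blast
  from switch_union[OF assms(1) this] show ?thesis
    using assms(2) by (simp add: Un_ac insert_commute)
qed

lemma switch_in_right:
  assumes "switch (edges (i + leaves l) r) (edges (i + leaves l) r') p q m k" "leaves r' = leaves r"
  shows "switch (edges i (Node l r)) (edges i (Node l r')) p q m k"
proof -
  have "(p, q) \<in> edges (i + leaves l) r" using assms by (simp add: switch_def)
  then have "(p, q) \<notin> edges i l \<union> {(i, i + leaves l + leaves r)}"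
    using not_in_disjoint_edges' by blast
  from switch_union[OF assms(1) this] show ?thesis
    using assms(2) by (simp add: Un_ac insert_commute)
qed

lemma rot_switch: "rot t t' \<Longrightarrow> \<exists>p q m k. switch (edges i t) (edges i t') p q m k"
proof (induction arbitrary: i rule: rot.induct)
  case (in_left l l' r)
  then show ?case using switch_in_left rot_leaves by metis
next
  case (in_right r r' l)
  then show ?case using switch_in_right rot_leaves by metis
qed (use switch_right switch_left in blast)+

text \<open>The converse of \<open>rot_switch\<close>, needed to realise a given flip as a step.
  \<open>p + 1 < q\<close> excludes boundary edges; the excluded root edge will be the diameter,
  which is flipped by the other kind of step.\<close>

lemma switch_at_edge:
  assumes "(p, q) \<in> edges i t" "p + 1 < q" "(p, q) \<noteq> (i, i + leaves t)"
  shows "\<exists>t' m k. rot t t' \<and> switch (edges i t) (edges i t') p q m k"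
  using assms
proof (induction t arbitrary: i)
  case Leaf
  then show ?case by auto
next
  case (Node l r)
  let ?m = "i + leaves l"
  from Node.prems consider "(p, q) \<in> edges i l" | "(p, q) \<in> edges ?m r" by (auto simp: add.assoc)
  then show ?case
  proof cases
    case 1
    show ?thesis
    proof (cases "(p, q) = (i, i + leaves l)")
      case True
      then obtain a b where l: "l = Node a b" using Node.prems by (cases l) auto
      with True have pq: "p = i" "q = i + leaves a + leaves b" by auto
      show ?thesis unfolding l pq using switch_right[of i a b r] rot.right[of a b r] by blast
    next
      case False
      from Node.IH(1)[OF 1 Node.prems(2) False] obtain l' m k
        where *: "rot l l'" "switch (edges i l) (edges i l') p q m k" by blast
      show ?thesis using switch_in_left[OF *(2) rot_leaves[OF *(1)]] rot.in_left[OF *(1)] by blast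
    qed
  next
    case 2
    show ?thesis
    proof (cases "(p, q) = (?m, ?m + leaves r)")
      case True
      then obtain a b where r: "r = Node a b" using Node.prems by (cases r) auto
      with True have pq: "p = ?m" "q = ?m + leaves a + leaves b" by auto
      show ?thesis unfolding r pq using switch_left[of i l a b] rot.left[of l a b] by blast
    next
      case False
      from Node.IH(2)[OF 2 Node.prems(2) False] obtain r' m k
        where *: "rot r r'" "switch (edges ?m r) (edges ?m r') p q m k" by blast
      show ?thesis using switch_in_right[OF *(2) rot_leaves[OF *(1)]] rot.in_right[OF *(1)] by blast
    qed
  qed
qed

section \<open>The centrally symmetric triangulation of a tree\<close>

lemma doubleton_minmax:
  fixes x y a b :: nat
  assumes "a < b"
  shows "{x, y} = {a, b} \<longleftrightarrow> min x y = a \<and> max x y = b"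
  using assms by (auto simp: doubleton_eq_iff min_def max_def)

lemma crosses_minmax:
  fixes x y u v :: nat
  shows "crosses {x, y} {u, v} \<longleftrightarrow>
    min x y < min u v \<and> min u v < max x y \<and> max x y < max u v \<or>
    min u v < min x y \<and> min x y < max u v \<and> max u v < max x y" (is "_ \<longleftrightarrow> ?R")
proof
  assume "crosses {x, y} {u, v}"
  then obtain a b p q where o: "a < p" "p < b" "b < q"
    and e: "{x, y} = {a, b} \<and> {u, v} = {p, q} \<or> {x, y} = {p, q} \<and> {u, v} = {a, b}"
    unfolding crosses_def by blast
  have ab: "a < b" and pq: "p < q" using o by linarith+
  from e show ?R
  proof (elim disjE conjE)
    assume "{x, y} = {a, b}" "{u, v} = {p, q}"
    then have "min x y = a" "max x y = b" "min u v = p" "max u v = q"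
      using doubleton_minmax[OF ab, of x y] doubleton_minmax[OF pq, of u v] by blast+
    then show ?R using o by simp
  next
    assume "{x, y} = {p, q}" "{u, v} = {a, b}"
    then have "min x y = p" "max x y = q" "min u v = a" "max u v = b"
      using doubleton_minmax[OF pq, of x y] doubleton_minmax[OF ab, of u v] by blast+
    then show ?R using o by simp
  qed
next
  have s: "{x, y} = {min x y, max x y}" "{u, v} = {min u v, max u v}" by (auto simp: min_def max_def)
  assume ?R
  then show "crosses {x, y} {u, v}"
  proof (elim disjE)
    assume "min x y < min u v \<and> min u v < max x y \<and> max x y < max u v"
    then show ?thesis unfolding crosses_def using s by blast
  next
    assume "min u v < min x y \<and> min x y < max u v \<and> max u v < max x y"
    then show ?thesis unfolding crosses_def using s by blast
  qed
qed

lemma crosses_iff: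
  fixes a b p q :: nat
  assumes "a < b" "p < q"
  shows "crosses {a, b} {p, q} \<longleftrightarrow> a < p \<and> p < b \<and> b < q \<or> p < a \<and> a < q \<and> q < b"
  using assms by (simp add: crosses_minmax)

lemma crossesI: "a < p \<Longrightarrow> p < b \<Longrightarrow> b < q \<Longrightarrow> crosses {a, b} {p, q}"
  unfolding crosses_def by blast

lemma crosses_sym: "crosses e f \<Longrightarrow> crosses f e"
  unfolding crosses_def by blast

locale polygon =
  fixes d N :: nat
  assumes N: "N = d + 1"
begin

abbreviation opp :: "nat \<Rightarrow> nat" where "opp \<equiv> opposite d"

lemma N_pos: "0 < N" using N by simp

lemma two_N: "2 * d + 2 = 2 * N" using N by simp

lemma opp_eq: "x < 2 * N \<Longrightarrow> opp x = (if x < N then x + N else x - N)"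
  unfolding opposite_def two_N using N by (auto simp: le_mod_geq)

lemma opp_mod: "opp x = (x + N) mod (2 * N)"
  unfolding opposite_def two_N N ..

lemma opp_less: "opp x < 2 * N"
  using N_pos by (simp add: opp_mod)

lemma opp_opp: "x < 2 * N \<Longrightarrow> opp (opp x) = x"
  by (auto simp: opp_eq)

lemma opp_image_opp: "e \<subseteq> {..<2 * N} \<Longrightarrow> opp ` opp ` e = e"
  by (force simp: opp_opp image_image)

text \<open>Reduction modulo 2N lets a tree start at any natural number, so that the second half is
  the same tree started at \<open>c + N\<close> and diameter flips need no wrap-around.\<close>

definition chord :: "nat \<times> nat \<Rightarrow> nat set" where
  "chord = (\<lambda>(p, q). {p mod (2 * N), q mod (2 * N)})"

definition half :: "nat \<Rightarrow> tree \<Rightarrow> nat set set" where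
  "half c t = chord ` edges c t"

definition tri :: "nat \<Rightarrow> tree \<Rightarrow> nat set set" where
  "tri c t = half c t \<union> half (c + N) t"

lemma opp_chord: "opp ` chord (p, q) = chord (p + N, q + N)"
  by (simp add: chord_def opp_mod mod_add_left_eq)

lemma half_shift: "half (c + N) t = (`) opp ` half c t"
  unfolding half_def edges_shift image_image
proof (rule image_cong)
  fix x :: "nat \<times> nat"
  show "chord (case x of (p, q) \<Rightarrow> (p + N, q + N)) = opp ` chord x"
    by (cases x) (simp only: opp_chord prod.case)
qed (rule refl)

lemma half_less: "e \<in> half c t \<Longrightarrow> e \<subseteq> {..<2 * N}"
  using N_pos by (auto simp: half_def chord_def)

lemma half_shift2: "half (c + N + N) t = half c t"
proof -
  have "half (c + N + N) t = (\<lambda>e. opp ` opp ` e) ` half c t"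
    by (simp add: half_shift image_image)
  also have "\<dots> = (\<lambda>e. e) ` half c t"
    by (rule image_cong) (use half_less opp_image_opp in auto)
  finally show ?thesis by simp
qed

lemma tri_shift: "tri (c + N) t = tri c t"
  unfolding tri_def half_shift2 by blast

lemma tri_shifts: "tri (c + k * N) t = tri c t"
proof (induction k)
  case (Suc k)
  have "tri (c + Suc k * N) t = tri (c + k * N + N) t" by (rule arg_cong[of _ _ "\<lambda>x. tri x t"]) simp
  also have "\<dots> = tri (c + k * N) t" by (rule tri_shift)
  finally show ?case using Suc by (rule trans)
next
  case 0
  show ?case unfolding mult_0 add_0_right ..
qed

lemma tri_mod: "tri (c mod N) t = tri c t"
  using tri_shifts[of "c mod N" "c div N" t] unfolding mod_div_mult_eq by (rule sym)

lemma tri_less: "e \<in> tri c t \<Longrightarrow> e \<subseteq> {..<2 * N}"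
  unfolding tri_def by (elim UnE) (erule half_less)+

lemma opp_half: "e \<in> half c t \<Longrightarrow> opp ` e \<in> half (c + N) t"
  unfolding half_shift by (rule imageI)

lemma opp_half_back: "e \<in> half (c + N) t \<Longrightarrow> opp ` e \<in> half c t"
  using opp_half[of e "c + N" t] unfolding half_shift2 .

lemma opp_tri: "e \<in> tri c t \<Longrightarrow> opp ` e \<in> tri c t"
  unfolding tri_def using opp_half opp_half_back by blast

text \<open>The half turn permutes the four endpoints cyclically, and alternation survives a cyclic
  shift. The five cases count how many of the labels wrap around.\<close>

lemma crosses_opp_aux:
  assumes "a < p" "p < b" "b < q" "q < 2 * N"
  shows "crosses {opp a, opp b} {opp p, opp q}"
proof -
  consider "q < N" | "b < N" "N \<le> q" | "p < N" "N \<le> b" | "a < N" "N \<le> p" | "N \<le> a" by linarith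
  then show ?thesis
  proof cases
    case 1
    then have "opp a = a + N" "opp p = p + N" "opp b = b + N" "opp q = q + N"
      using assms by (simp_all add: opp_eq)
    then show ?thesis using crossesI[of "a + N" "p + N" "b + N" "q + N"] assms by simp
  next
    case 2
    then have "opp a = a + N" "opp p = p + N" "opp b = b + N" "opp q = q - N"
      using assms by (simp_all add: opp_eq)
    then show ?thesis
      using crosses_sym[OF crossesI[of "q - N" "a + N" "p + N" "b + N"]] assms 2 by (simp add: insert_commute)
  next
    case 3
    then have "opp a = a + N" "opp p = p + N" "opp b = b - N" "opp q = q - N"
      using assms by (simp_all add: opp_eq)
    then show ?thesis
      using crossesI[of "b - N" "q - N" "a + N" "p + N"] assms 3 by (simp add: insert_commute)
  next
    case 4
    then have "opp a = a + N" "opp p = p - N" "opp b = b - N" "opp q = q - N"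
      using assms by (simp_all add: opp_eq)
    then show ?thesis
      using crosses_sym[OF crossesI[of "p - N" "b - N" "q - N" "a + N"]] assms 4 by (simp add: insert_commute)
  next
    case 5
    then have "opp a = a - N" "opp p = p - N" "opp b = b - N" "opp q = q - N"
      using assms by (simp_all add: opp_eq)
    then show ?thesis using crossesI[of "a - N" "p - N" "b - N" "q - N"] assms 5 by simp
  qed
qed

lemma crosses_opp:
  assumes "crosses e f" "e \<subseteq> {..<2 * N}" "f \<subseteq> {..<2 * N}"
  shows "crosses (opp ` e) (opp ` f)"
proof -
  obtain a b p q where o: "a < p" "p < b" "b < q"
    and ef: "e = {a, b} \<and> f = {p, q} \<or> e = {p, q} \<and> f = {a, b}"
    using assms(1) unfolding crosses_def by blast
  have "q \<in> e \<union> f" using ef by (elim disjE) simp_all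
  then have "q \<in> {..<2 * N}" using assms(2,3) by blast
  then have "q < 2 * N" by simp
  note x = crosses_opp_aux[OF o this]
  from ef show ?thesis
  proof (elim disjE conjE)
    assume "e = {a, b}" "f = {p, q}"
    then show ?thesis using x by simp
  next
    assume "e = {p, q}" "f = {a, b}"
    then show ?thesis using crosses_sym[OF x] by simp
  qed
qed

section \<open>The union of the two halves is a vertex of the graph\<close>

context
  fixes c :: nat and t :: tree
  assumes c: "c < N" and t: "leaves t = N"
begin

lemma half_eq: "half c t = (\<lambda>(p, q). {p, q}) ` edges c t"
  unfolding half_def chord_def
proof (rule image_cong)
  fix e assume "e \<in> edges c t"
  then show "(case e of (p, q) \<Rightarrow> {p mod (2 * N), q mod (2 * N)}) = (case e of (p, q) \<Rightarrow> {p, q})"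
    using edges_bounds[of "fst e" "snd e" c t] c t by (cases e) auto
qed simp

lemma half_iff: "p < q \<Longrightarrow> {p, q} \<in> half c t \<longleftrightarrow> (p, q) \<in> edges c t"
  unfolding half_eq using edges_bounds by (fastforce simp: doubleton_eq_iff)

lemma halfE:
  assumes "e \<in> half c t"
  obtains p q where "e = {p, q}" "(p, q) \<in> edges c t" "c \<le> p" "p < q" "q \<le> c + N"
proof -
  from assms obtain x where x: "x \<in> edges c t" "e = (case x of (p, q) \<Rightarrow> {p, q})"
    unfolding half_eq by (elim imageE)
  obtain p q where pq: "x = (p, q)" by (cases x)
  with x(1) have "(p, q) \<in> edges c t" by simp
  then show thesis using that[of p q] edges_bounds[of p q c t] x(2) pq t by simp
qed

lemma opp_halfE:
  assumes "e \<in> half (c + N) t"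
  obtains p q where "e = {opp p, opp q}" "(p, q) \<in> edges c t" "c \<le> p" "p < q" "q \<le> c + N"
proof -
  from assms obtain f where f: "f \<in> half c t" "e = opp ` f" unfolding half_shift by (elim imageE)
  obtain p q where pq: "f = {p, q}" "(p, q) \<in> edges c t" "c \<le> p" "p < q" "q \<le> c + N"
    by (rule halfE[OF f(1)])
  show thesis by (rule that[OF _ pq(2-5)]) (simp add: f(2) pq(1))
qed

lemma opp_inside:
  assumes "c \<le> x" "x \<le> c + N"
  shows "opp x < 2 * N \<and> \<not> (c < opp x \<and> opp x < c + N)"
  using assms c opp_less[of x] by (auto simp: opp_eq)

lemma opp_outside:
  assumes "x < 2 * N" "\<not> (c < x \<and> x < c + N)"
  shows "c \<le> opp x \<and> opp x \<le> c + N"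
  using assms c by (auto simp: opp_eq)

lemma half_noncrossing:
  assumes "e \<in> half c t" "f \<in> half c t" shows "\<not> crosses e f"
proof -
  obtain p q where e: "e = {p, q}" "(p, q) \<in> edges c t" "p < q" by (rule halfE[OF assms(1)])
  obtain r s where f: "f = {r, s}" "(r, s) \<in> edges c t" "r < s" by (rule halfE[OF assms(2)])
  show ?thesis unfolding e(1) f(1) crosses_iff[OF e(3) f(3)]
    using edges_noncrossing[OF e(2) f(2)] edges_noncrossing[OF f(2) e(2)] by blast
qed

lemma half_opp_noncrossing:
  assumes "e \<in> half c t" "f \<in> half (c + N) t" shows "\<not> crosses e f"
proof -
  obtain p q where e: "e = {p, q}" "c \<le> p" "p < q" "q \<le> c + N"
    by (rule halfE[OF assms(1)])
  obtain r s where f: "f = {opp r, opp s}" "c \<le> r" "r < s" "s \<le> c + N"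
    by (rule opp_halfE[OF assms(2)])
  have "\<not> (c < opp r \<and> opp r < c + N)" "\<not> (c < opp s \<and> opp s < c + N)"
    using opp_inside f by auto
  then show ?thesis using e unfolding f(1) e(1) crosses_minmax by (auto simp: min_def max_def)
qed

lemma tri_noncrossing:
  assumes "e \<in> tri c t" "f \<in> tri c t" shows "\<not> crosses e f"
proof
  assume x: "crosses e f"
  from assms consider "e \<in> half c t" "f \<in> half c t" | "e \<in> half c t" "f \<in> half (c + N) t"
    | "e \<in> half (c + N) t" "f \<in> half c t" | "e \<in> half (c + N) t" "f \<in> half (c + N) t"
    unfolding tri_def by (elim UnE) simp_all
  then show False
  proof cases
    case 4
    show False
      using half_noncrossing[OF opp_half_back[OF 4(1)] opp_half_back[OF 4(2)]]
        crosses_opp[OF x half_less[OF 4(1)] half_less[OF 4(2)]] by (rule notE)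
  next
    case 1 show False using half_noncrossing[OF 1] x by (rule notE)
  next
    case 2 show False using half_opp_noncrossing[OF 2] x by (rule notE)
  next
    case 3 show False using half_opp_noncrossing[OF 3(2,1)] crosses_sym[OF x] by (rule notE)
  qed
qed

lemma diameter_in_tri: "{c, c + N} \<in> tri c t"
  using root_edge[of c t] t N_pos unfolding tri_def by (simp add: half_iff)

lemma tri_polygon_edges: "tri c t \<subseteq> polygon_edges d"
proof
  fix e assume e: "e \<in> tri c t"
  then consider "e \<in> half c t" | "e \<in> half (c + N) t" unfolding tri_def by blast
  then show "e \<in> polygon_edges d"
  proof cases
    case 1
    obtain p q where "e = {p, q}" "p < q" "q \<le> c + N" by (rule halfE[OF 1])
    then have "e = {p, q} \<and> p < 2 * N \<and> q < 2 * N \<and> p \<noteq> q" using c by simp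
    then show ?thesis unfolding polygon_edges_def two_N by blast
  next
    case 2
    obtain p q where e: "e = {opp p, opp q}" "p < q" "q \<le> c + N" by (rule opp_halfE[OF 2])
    then have "opp (opp p) = p" "opp (opp q) = q" using c by (simp_all add: opp_opp)
    then have "opp p \<noteq> opp q" using e(2) by (metis less_irrefl)
    then show ?thesis using e opp_less unfolding polygon_edges_def two_N by blast
  qed
qed

lemma inside_maximal:
  assumes "c \<le> u" "u < v" "v \<le> c + N" "{u, v} \<notin> half c t"
  shows "\<exists>f \<in> half c t. crosses {u, v} f"
proof -
  have "(u, v) \<notin> edges c t" using assms half_iff by blast
  from edges_maximal[OF assms(1,2) _ this] assms(3) t
  obtain p q where pq: "(p, q) \<in> edges c t" "p < u \<and> u < q \<and> q < v \<or> u < p \<and> p < v \<and> v < q" by auto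
  then have "p < q" using edges_bounds by blast
  then have "{p, q} \<in> half c t" "crosses {u, v} {p, q}"
    using pq half_iff assms(2) by (auto simp: crosses_iff)
  then show ?thesis by blast
qed

lemma tri_maximal:
  assumes "e \<in> polygon_edges d" "e \<notin> tri c t"
  shows "\<exists>f \<in> tri c t. crosses e f"
proof -
  obtain x y where "e = {x, y}" "x < 2 * N" "y < 2 * N" "x \<noteq> y"
    using assms(1) unfolding polygon_edges_def two_N by blast
  then obtain u v where e: "e = {u, v}" "u < v" "v < 2 * N"
    by (metis insert_commute linorder_neqE_nat)
  let ?in = "\<lambda>x. c < x \<and> x < c + N"
  \<comment> \<open>The edge lies in the closed arc from c to c + N, or in the complementary closed
    arc (moved back by the half turn), or it crosses the diameter.\<close>
  consider "c \<le> u" "v \<le> c + N" | "\<not> ?in u" "\<not> ?in v" | "?in u" "c + N < v" | "u < c" "?in v"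
    using e by linarith
  then show ?thesis
  proof cases
    case 1
    then show ?thesis using inside_maximal[of u v] e(1,2) assms(2) unfolding tri_def e(1) by blast
  next
    case 2
    have ul: "u < 2 * N" using e by simp
    define u' v' where "u' = min (opp u) (opp v)" and "v' = max (opp u) (opp v)"
    have "opp u \<noteq> opp v" using opp_opp[OF ul] opp_opp[OF e(3)] e(2) by (metis less_irrefl)
    then have lt: "u' < v'" unfolding u'_def v'_def by auto
    have oe: "opp ` e = {u', v'}" unfolding e(1) u'_def v'_def by (auto simp: min_def max_def)
    have b: "c \<le> u'" "v' \<le> c + N"
      using opp_outside[OF ul 2(1)] opp_outside[OF e(3) 2(2)] unfolding u'_def v'_def by auto
    have el: "e \<subseteq> {..<2 * N}" using e by auto
    have "opp ` e \<notin> half c t"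
    proof
      assume "opp ` e \<in> half c t"
      then have "opp ` opp ` e \<in> half (c + N) t" by (rule opp_half)
      then show False using assms(2) unfolding opp_image_opp[OF el] tri_def by simp
    qed
    then obtain f where f: "f \<in> half c t" "crosses (opp ` e) f"
      using inside_maximal[OF b(1) lt b(2)] unfolding oe by blast
    have "opp ` e \<subseteq> {..<2 * N}" using opp_less by (simp add: image_subset_iff)
    from crosses_opp[OF f(2) this half_less[OF f(1)]]
    have "crosses e (opp ` f)" unfolding opp_image_opp[OF el] .
    moreover have "opp ` f \<in> tri c t" using opp_half[OF f(1)] by (simp add: tri_def)
    ultimately show ?thesis by blast
  next
    case 3
    then have "crosses e {c, c + N}" unfolding e(1) by (auto simp: crosses_iff)
    then show ?thesis using diameter_in_tri by blast
  next
    case 4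
    then have "crosses e {c, c + N}" unfolding e(1) by (auto simp: crosses_iff)
    then show ?thesis using diameter_in_tri by blast
  qed
qed

lemma tri_vertex: "tri c t \<in> cyclohedron_vertices d"
proof -
  have "noncrossing_edges d (tri c t)"
    unfolding noncrossing_edges_def using tri_polygon_edges tri_noncrossing by blast
  moreover have "S = tri c t" if "noncrossing_edges d S" "tri c t \<subseteq> S" for S
    using that tri_maximal unfolding noncrossing_edges_def by blast
  moreover have "centrally_symmetric d (tri c t)"
    unfolding centrally_symmetric_def using opp_tri[of "{_, _}" c t] by simp
  ultimately show ?thesis unfolding cyclohedron_vertices_def triangulation_def by blast
qed

end

end

section \<open>Flips as rotations\<close>

inductive step :: "nat \<times> tree \<Rightarrow> nat \<times> tree \<Rightarrow> bool" where
  rot: "rot t t' \<Longrightarrow> step (c, t) (c, t')"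
| diameter: "step (c, Node l r) (c + leaves l, Node r l)"

lemma step_leaves: "step s s' \<Longrightarrow> leaves (snd s') = leaves (snd s)"
  by (induction rule: step.induct) (auto dest: rot_leaves)

section \<open>Every vertex of the graph comes from a tree\<close>

context polygon
begin

lemma vertex_mem:
  assumes T: "T \<in> cyclohedron_vertices d" and xy: "x < 2 * N" "y < 2 * N" "x \<noteq> y"
    and nc: "\<And>f. f \<in> T \<Longrightarrow> \<not> crosses {x, y} f"
  shows "{x, y} \<in> T"
proof -
  have nT: "noncrossing_edges d T" and mx: "\<And>S. noncrossing_edges d S \<Longrightarrow> T \<subseteq> S \<Longrightarrow> S = T"
    using T unfolding cyclohedron_vertices_def triangulation_def by blast+
  have self: "\<not> crosses {x, y} {x, y}"
    by (simp add: crosses_minmax)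
  have "{x, y} \<in> polygon_edges d" using xy unfolding polygon_edges_def two_N by blast
  then have "noncrossing_edges d (insert {x, y} T)"
    using nT nc self crosses_sym[of _ "{x, y}"] unfolding noncrossing_edges_def by blast
  from mx[OF this] show ?thesis by blast
qed

lemma vertex_noncrossing:
  "T \<in> cyclohedron_vertices d \<Longrightarrow> e \<in> T \<Longrightarrow> f \<in> T \<Longrightarrow> \<not> crosses e f"
  unfolding cyclohedron_vertices_def triangulation_def noncrossing_edges_def by blast

lemma vertex_edgeE:
  assumes "T \<in> cyclohedron_vertices d" "e \<in> T"
  obtains p q where "e = {p, q}" "p < q" "q < 2 * N"
proof -
  have "e \<in> polygon_edges d"
    using assms unfolding cyclohedron_vertices_def triangulation_def noncrossing_edges_def by blast
  then obtain x y where "e = {x, y}" "x < 2 * N" "y < 2 * N" "x \<noteq> y"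
    unfolding polygon_edges_def two_N by blast
  then show thesis using that[of x y] that[of y x] by (cases "x < y") (auto simp: insert_commute)
qed

lemma vertex_opp:
  "T \<in> cyclohedron_vertices d \<Longrightarrow> {x, y} \<in> T \<Longrightarrow> {opp x, opp y} \<in> T"
  unfolding cyclohedron_vertices_def centrally_symmetric_def by blast

lemma vertex_boundary:
  assumes "T \<in> cyclohedron_vertices d" "x + 1 < 2 * N"
  shows "{x, x + 1} \<in> T"
proof (rule vertex_mem[OF assms(1)])
  fix f assume "f \<in> T"
  from vertex_edgeE[OF assms(1) this] obtain p q where "f = {p, q}" "p < q" by metis
  then show "\<not> crosses {x, x + 1} f" by (auto simp: crosses_iff)
qed (use assms in auto)

lemma vertex_boundary_last:
  assumes "T \<in> cyclohedron_vertices d"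
  shows "{0, 2 * N - 1} \<in> T"
proof (rule vertex_mem[OF assms])
  fix f assume "f \<in> T"
  from vertex_edgeE[OF assms this] obtain p q where "f = {p, q}" "p < q" "q < 2 * N" by metis
  moreover have "0 < 2 * N - 1" using N_pos by simp
  ultimately show "\<not> crosses {0, 2 * N - 1} f" by (auto simp: crosses_iff)
qed (use N_pos in auto)

text \<open>The apex is the last neighbour of \<open>i\<close> before \<open>k\<close>: an edge crossing \<open>{m, k}\<close> would
  have to end in \<open>i\<close>, contradicting the choice of \<open>m\<close>.\<close>

lemma vertex_split:
  assumes T: "T \<in> cyclohedron_vertices d" and e: "{i, k} \<in> T" "i + 1 < k" "k < 2 * N"
  shows "\<exists>m. i < m \<and> m < k \<and> {i, m} \<in> T \<and> {m, k} \<in> T"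
proof -
  let ?A = "{m. i < m \<and> m < k \<and> {i, m} \<in> T}"
  have "i + 1 \<in> ?A" using vertex_boundary[OF T, of i] e by simp
  then have ne: "?A \<noteq> {}" by blast
  have fin: "finite ?A" by (rule finite_subset[of _ "{..<k}"]) auto
  define m where "m = Max ?A"
  have m: "i < m" "m < k" "{i, m} \<in> T" using Max_in[OF fin ne] unfolding m_def by auto
  have mx: "x \<le> m" if "i < x" "x < k" "{i, x} \<in> T" for x
    using Max_ge[OF fin, of x] that unfolding m_def by blast
  have "{m, k} \<in> T"
  proof (rule vertex_mem[OF T])
    fix f assume f: "f \<in> T"
    from vertex_edgeE[OF T f] obtain p q where pq: "f = {p, q}" "p < q" by metis
    have ik: "i < k" using e by simp
    have n1: "\<not> crosses {i, k} {p, q}" "\<not> crosses {i, m} {p, q}"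
      using vertex_noncrossing[OF T] e(1) m(3) f pq(1) by metis+
    have x: False if c: "m < p \<and> p < k \<and> k < q \<or> p < m \<and> m < q \<and> q < k"
    proof -
      have "p = i" "m < q" "q < k"
        using n1 c m(1,2) pq(2) unfolding crosses_iff[OF ik pq(2)] crosses_iff[OF m(1) pq(2)] by linarith+
      then show False using mx[of q] f pq m(1) by auto
    qed
    then show "\<not> crosses {m, k} f" unfolding pq(1) crosses_iff[OF m(2) pq(2)] by blast
  qed (use m e in auto)
  then show ?thesis using m by blast
qed

text \<open>Descent to the triangle at the centre: split an edge of span at least N and continue
  with a piece that still has span at least N. If both pieces are shorter than N, the centre lies
  strictly inside the triangle, and the opposite of its side \<open>{i, m}\<close> crosses
  \<open>{m, k}\<close>, against central symmetry.\<close>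

lemma vertex_diameter:
  assumes T: "T \<in> cyclohedron_vertices d" and "{i, k} \<in> T" "k < 2 * N" "i + N \<le> k"
  shows "\<exists>c < N. {c, c + N} \<in> T"
  using assms(2-4)
proof (induction "k - i" arbitrary: i k rule: less_induct)
  case less
  show ?case
  proof (cases "k = i + N")
    case True
    then show ?thesis using less.prems by (intro exI[of _ i]) auto
  next
    case False
    then have k: "i + N < k" using less.prems by simp
    then obtain m where m: "i < m" "m < k" "{i, m} \<in> T" "{m, k} \<in> T"
      using vertex_split[OF T less.prems(1)] less.prems(2) N_pos by auto
    consider "i + N \<le> m" | "m + N \<le> k" | "m < i + N" "k < m + N" by linarith
    then show ?thesis
    proof cases
      case 1
      show ?thesis by (rule less.hyps[OF _ m(3)]) (use m less.prems 1 in auto)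
    next
      case 2
      show ?thesis by (rule less.hyps[OF _ m(4)]) (use m less.prems 2 in auto)
    next
      case 3
      have i: "i < N" using k less.prems by simp
      have o: "{i + N, opp m} \<in> T"
        using vertex_opp[OF T m(3)] i by (simp add: opp_eq)
      have "crosses {m, k} {i + N, opp m}"
      proof (cases "m < N")
        case True
        then show ?thesis using crossesI[of m "i + N" k "m + N"] 3 k by (simp add: opp_eq)
      next
        case False
        then have "opp m = m - N" using m less.prems by (simp add: opp_eq)
        then show ?thesis
          using crosses_sym[OF crossesI[of "m - N" m "i + N" k]] 3 k m False N_pos
          by (simp add: insert_commute)
      qed
      then show ?thesis using vertex_noncrossing[OF T m(4) o] by blast
    qed
  qed
qed

lemma vertex_subtree:
  assumes T: "T \<in> cyclohedron_vertices d" and "{i, k} \<in> T" "i < k" "k < 2 * N"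
  shows "\<exists>t. leaves t = k - i \<and> (\<forall>(p, q) \<in> edges i t. {p, q} \<in> T)"
  using assms(2-4)
proof (induction "k - i" arbitrary: i k rule: less_induct)
  case less
  show ?case
  proof (cases "k = i + 1")
    case True
    then show ?thesis using less.prems by (intro exI[of _ Leaf]) auto
  next
    case False
    then obtain m where m: "i < m" "m < k" "{i, m} \<in> T" "{m, k} \<in> T"
      using vertex_split[OF T less.prems(1)] less.prems by auto
    obtain l where l: "leaves l = m - i" "\<forall>(p, q) \<in> edges i l. {p, q} \<in> T"
    proof -
      have "m - i < k - i" "m < 2 * N" using m less.prems by linarith+
      from less.hyps[OF this(1) m(3,1) this(2)] that show thesis by blast
    qed
    obtain r where r: "leaves r = k - m" "\<forall>(p, q) \<in> edges m r. {p, q} \<in> T"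
    proof -
      have "k - m < k - i" using m by linarith
      from less.hyps[OF this m(4,2) less.prems(3)] that show thesis by blast
    qed
    show ?thesis
      by (rule exI[of _ "Node l r"]) (use l r m less.prems in auto)
  qed
qed

lemma vertex_tri:
  assumes T: "T \<in> cyclohedron_vertices d"
  shows "\<exists>c t. c < N \<and> leaves t = N \<and> T = tri c t"
proof -
  obtain c where c: "c < N" "{c, c + N} \<in> T"
  proof -
    have "2 * N - 1 < 2 * N" "0 + N \<le> 2 * N - 1" using N_pos by linarith+
    from vertex_diameter[OF T vertex_boundary_last[OF T] this] that show thesis by blast
  qed
  obtain t where t: "leaves t = N" "\<forall>(p, q) \<in> edges c t. {p, q} \<in> T"
    using vertex_subtree[OF T c(2)] c(1) N_pos by auto
  have h: "half c t \<subseteq> T" unfolding half_eq[OF c(1) t(1)] using t(2) by auto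
  have "half (c + N) t \<subseteq> T"
  proof
    fix e assume "e \<in> half (c + N) t"
    from opp_halfE[OF c(1) t(1) this] obtain p q where "e = {opp p, opp q}" "(p, q) \<in> edges c t" by metis
    then show "e \<in> T" using t(2) vertex_opp[OF T] by auto
  qed
  with h have sub: "tri c t \<subseteq> T" unfolding tri_def by blast
  have "noncrossing_edges d T" using T unfolding cyclohedron_vertices_def triangulation_def by blast
  with sub tri_vertex[OF c(1) t(1)] have "T = tri c t"
    unfolding cyclohedron_vertices_def triangulation_def by blast
  with c t show ?thesis by blast
qed

section \<open>Matching flips with steps\<close>

definition quad :: "nat set set \<Rightarrow> nat \<Rightarrow> nat \<Rightarrow> nat \<Rightarrow> nat \<Rightarrow> bool" where
  "quad T p q m k \<longleftrightarrow> p < m \<and> m < q \<and> q < 2 * N \<and> (q < k \<and> k < 2 * N \<or> k < p) \<and>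
     {p, q} \<in> T \<and> {p, m} \<in> T \<and> {m, q} \<in> T \<and> {p, k} \<in> T \<and> {q, k} \<in> T"

definition exchange :: "nat set set \<Rightarrow> nat \<Rightarrow> nat \<Rightarrow> nat \<Rightarrow> nat \<Rightarrow> nat set set" where
  "exchange T p q m k = (T - {{p, q}, {opp p, opp q}}) \<union> {{m, k}, {opp m, opp k}}"

lemma quad_flip:
  assumes "quad T p q m k" shows "flip d T (exchange T p q m k)"
proof -
  have o: "p < m" "m < q" "q < 2 * N" "q < k \<and> k < 2 * N \<or> k < p" using assms unfolding quad_def by blast+
  have "{p, q} \<notin> boundary_edges d"
  proof
    assume "{p, q} \<in> boundary_edges d"
    then obtain x where x: "{p, q} = {x, (x + 1) mod (2 * N)}" "x < 2 * N"
      unfolding boundary_edges_def two_N by blast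
    show False
    proof (cases "x + 1 < 2 * N")
      case True
      then show False using x o by (auto simp: doubleton_eq_iff)
    next
      case False
      then have "x + 1 = 2 * N" using x by simp
      then have "(x + 1) mod (2 * N) = 0" by simp
      then show False using x o \<open>x + 1 = 2 * N\<close> by (auto simp: doubleton_eq_iff)
    qed
  qed
  moreover have "crosses {p, q} {m, k}" using o by (auto simp: crosses_minmax)
  ultimately show ?thesis
    using assms unfolding flip_def exchange_def quad_def
    by (intro exI[of _ p] exI[of _ q] exI[of _ m] exI[of _ k]) (simp add: insert_commute)
qed

text \<open>\<open>flip\<close> leaves the two new endpoints existential. Two different apices on
  the same side of an edge would yield crossing sides, so they agree with those supplied by the
  tree.\<close>

lemma quad_unique:
  assumes nc: "\<And>e f. e \<in> T \<Longrightarrow> f \<in> T \<Longrightarrow> \<not> crosses e f" and q: "quad T p q m k"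
    and a: "p < a" "a < q" "{p, a} \<in> T" "{a, q} \<in> T"
    and b: "b < p \<or> q < b" "{p, b} \<in> T" "{q, b} \<in> T"
  shows "a = m" "b = k"
proof -
  have o: "p < m" "m < q" "q < k \<and> k < 2 * N \<or> k < p"
    and T: "{p, m} \<in> T" "{m, q} \<in> T" "{p, k} \<in> T" "{q, k} \<in> T"
    using q unfolding quad_def by blast+
  have n: "\<not> crosses {p, m} {a, q}" "\<not> crosses {p, a} {m, q}" "\<not> crosses {p, b} {q, k}"
    "\<not> crosses {q, b} {p, k}"
    using nc T a b by blast+
  show "a = m"
    using n(1,2) o a(1,2) by (simp add: crosses_iff) 
  show "b = k"
    using n(3,4) o a(1,2) b(1) by (auto simp: crosses_minmax min_def max_def split: if_splits)
qed

lemma half_Int: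
  assumes "c < N" "leaves t = N" "e \<in> half c t" "e \<in> half (c + N) t"
  shows "e = {c, c + N}"
proof -
  obtain p q where e: "e = {p, q}" "c \<le> p" "p < q" "q \<le> c + N" by (rule halfE[OF assms(1,2,3)])
  obtain r s where f: "e = {opp r, opp s}" "c \<le> r" "r < s" "s \<le> c + N" by (rule opp_halfE[OF assms(1,2,4)])
  have "\<not> (c < opp r \<and> opp r < c + N)" "\<not> (c < opp s \<and> opp s < c + N)"
    using opp_inside[OF assms(1,2)] f by auto
  then have "\<not> (c < x \<and> x < c + N)" if "x \<in> e" for x using that f(1) by auto
  from this[of p] this[of q] e show ?thesis by auto
qed

lemma half_exchange:
  assumes "(p, q) \<in> E" "\<And>x y. (x, y) \<in> E \<Longrightarrow> x < y"
  shows "(\<lambda>(p, q). {p, q}) ` (E - {(p, q)} \<union> {(m, k)}) = (\<lambda>(p, q). {p, q}) ` E - {{p, q}} \<union> {{m, k :: nat}}"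
proof -
  have "inj_on (\<lambda>(p, q). {p, q}) E"
    by (rule inj_onI) (auto simp: doubleton_eq_iff dest!: assms(2))
  then have "(\<lambda>(p, q). {p, q}) ` (E - {(p, q)}) = (\<lambda>(p, q). {p, q}) ` E - (\<lambda>(p, q). {p, q}) ` {(p, q)}"
    by (rule inj_on_image_set_diff) (use assms(1) in auto)
  then show ?thesis by (simp add: image_Un)
qed

lemma opp_image_exchange:
  assumes "\<And>e. e \<in> H \<Longrightarrow> e \<subseteq> {..<2 * N}" "e0 \<in> H"
  shows "(`) opp ` (H - {e0} \<union> {f0}) = (`) opp ` H - {opp ` e0} \<union> {opp ` f0}"
proof -
  have "inj_on ((`) opp) H"
    using assms(1) opp_image_opp by (metis inj_onI)
  then have "(`) opp ` (H - {e0}) = (`) opp ` H - (`) opp ` {e0}"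
    by (rule inj_on_image_set_diff) (use assms(2) in auto)
  then show ?thesis by (simp add: image_Un)
qed

lemma switch_tri:
  assumes c: "c < N" and t: "leaves t = N" and t': "leaves t' = N"
    and sw: "switch (edges c t) (edges c t') p q m k"
  shows "quad (tri c t) p q m k" "tri c t' = exchange (tri c t) p q m k"
proof -
  let ?E = "edges c t" and ?H = "half c t"
  have lt: "c \<le> x \<and> x < y \<and> y \<le> c + N" if "(x, y) \<in> ?E" for x y
    using edges_bounds[OF that] t by simp
  have e: "p < m" "m < q" "(p, q) \<in> ?E" "(p, m) \<in> ?E" "(m, q) \<in> ?E" using sw unfolding switch_def by blast+
  have mem: "{x, y} \<in> ?H" if "(x, y) \<in> ?E" for x y
    using imageI[OF that, of "\<lambda>(p, q). {p, q}"] unfolding half_eq[OF c t] by simp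
  have ltE: "\<And>x y. (x, y) \<in> ?E \<Longrightarrow> x < y" using lt by blast
  have main: "half c t' = ?H - {{p, q}} \<union> {{m, k}} \<and> {p, k} \<in> ?H \<and> {q, k} \<in> ?H \<and>
      (q < k \<and> k \<le> c + N \<or> k < p) \<and> (p, q) \<noteq> (c, c + N)"
  proof (cases "q < k")
    case True
    then have k: "(p, k) \<in> ?E" "(q, k) \<in> ?E" "edges c t' = ?E - {(p, q)} \<union> {(m, k)}"
      using sw e unfolding switch_def by auto
    have "half c t' = ?H - {{p, q}} \<union> {{m, k}}"
      unfolding half_eq[OF c t] half_eq[OF c t'] k(3) by (rule half_exchange[OF e(3) ltE])
    then show ?thesis using mem[OF k(1)] mem[OF k(2)] lt[OF k(1)] True by auto
  next
    case False
    then have k: "(k, p) \<in> ?E" "(k, q) \<in> ?E" "edges c t' = ?E - {(p, q)} \<union> {(k, m)}" "k < p"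
      using sw e unfolding switch_def by auto
    have "half c t' = ?H - {{p, q}} \<union> {{k, m}}"
      unfolding half_eq[OF c t] half_eq[OF c t'] k(3) by (rule half_exchange[OF e(3) ltE])
    then show ?thesis using mem[OF k(1)] mem[OF k(2)] lt[OF k(1)] k(4) by (auto simp: insert_commute)
  qed
  then have H': "half c t' = ?H - {{p, q}} \<union> {{m, k}}" and kT: "{p, k} \<in> ?H" "{q, k} \<in> ?H"
    "q < k \<and> k \<le> c + N \<or> k < p" and npq: "(p, q) \<noteq> (c, c + N)" by blast+
  have "quad (half c t) p q m k"
    unfolding quad_def using e(1,2) mem[OF e(3)] mem[OF e(4)] mem[OF e(5)] kT lt[OF e(3)] c by auto
  then show "quad (tri c t) p q m k" unfolding quad_def tri_def by blast
  have ne: "{p, q} \<noteq> {c, c + N}" using npq lt[OF e(3)] by (auto simp: doubleton_eq_iff)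
  \<comment> \<open>The halves share only the diameter. Therefore deleting \<open>{p, q}\<close> and
    its opposite removes exactly one edge from each half.\<close>
  have n1: "{p, q} \<notin> half (c + N) t" using half_Int[OF c t mem[OF e(3)]] ne by blast
  have n2: "{opp p, opp q} \<notin> half c t"
  proof
    assume "{opp p, opp q} \<in> half c t"
    then have "opp ` {opp p, opp q} \<in> half (c + N) t" by (rule opp_half)
    then show False using n1 lt[OF e(3)] c by (simp add: opp_opp)
  qed
  have O': "half (c + N) t' = half (c + N) t - {{opp p, opp q}} \<union> {{opp m, opp k}}"
    unfolding half_shift H' by (subst opp_image_exchange[OF half_less mem[OF e(3)]]) auto
  show "tri c t' = exchange (tri c t) p q m k"
    unfolding tri_def exchange_def H' O' using n1 n2 by blast
qed

text \<open>The new half starts at the apex m: it first meets the old right subtree up to c + N and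
  then the opposite copy of the left subtree, whence \<open>Node r l\<close>. The diameter is its
  own opposite, so a single edge is exchanged.\<close>

lemma diameter_tri:
  assumes c: "c < N" and t: "leaves (Node l r) = N"
  defines "m \<equiv> c + leaves l"
  shows "quad (tri c (Node l r)) c (c + N) m (opp m)"
    "tri m (Node r l) = exchange (tri c (Node l r)) c (c + N) m (opp m)"
proof -
  let ?t = "Node l r"
  have m: "c < m" "m < c + N" "m + leaves r = c + N" "m < 2 * N" using c t unfolding m_def by auto
  have om: "c + N < opp m \<and> opp m < 2 * N \<or> opp m < c" using m by (auto simp: opp_eq)
  have oc: "opp c = c + N" "opp (c + N) = c" using c by (auto simp: opp_eq)
  have lt: "\<And>x y. (x, y) \<in> edges c l \<Longrightarrow> c \<le> x \<and> x < y \<and> y \<le> m" 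
    "\<And>x y. (x, y) \<in> edges m r \<Longrightarrow> m \<le> x \<and> x < y \<and> y \<le> c + N"
    using edges_bounds[of _ _ c l] edges_bounds[of _ _ m r] m(3) unfolding m_def by auto
  have e: "(c, m) \<in> edges c ?t" "(m, c + N) \<in> edges c ?t" "(c, c + N) \<in> edges c ?t"
    using root_edge[of c l] root_edge[of m r] root_edge[of c ?t] m(3) t unfolding m_def by auto
  have h: "{c, m} \<in> half c ?t" "{m, c + N} \<in> half c ?t" "{c, c + N} \<in> half c ?t"
    using e m by (simp_all add: half_iff[OF c t])
  have "{c, opp m} \<in> half (c + N) ?t" "{c + N, opp m} \<in> half (c + N) ?t"
    using opp_half[OF h(1)] opp_half[OF h(2)] oc by (auto simp: insert_commute)
  then show "quad (tri c ?t) c (c + N) m (opp m)"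
    unfolding quad_def tri_def using m c om h by auto
  let ?R = "half c l \<union> half m r \<union> (half (c + N) l \<union> half (m + N) r)"
  have ch: "chord (c, c + N) = {c, c + N}" "chord (c + N, c + N + N) = {c, c + N}"
    "chord (m, m + N) = {m, opp m}" "chord (m + N, m + N + N) = {m, opp m}"
    using c m by (auto simp: chord_def opp_mod add.assoc simp flip: mult_2)
  have hN: "half i (Node a b) = insert (chord (i, i + leaves a + leaves b)) (half i a \<union> half (i + leaves a) b)" for i a b
    unfolding half_def by (simp add: image_Un)
  have l1: "c + leaves l + leaves r = c + N" "c + N + leaves l + leaves r = c + N + N"
    "c + N + leaves l = m + N" "m + leaves r + leaves l = m + N" "m + N + leaves r + leaves l = m + N + N"
    "m + N + leaves r = c + N + N" "c + N + N + leaves l = m + N + N"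
    using t m(3) unfolding m_def by auto
  have T: "tri c ?t = insert {c, c + N} ?R"
    unfolding tri_def hN l1 ch m_def[symmetric] m(3) by blast
  have T': "tri m (Node r l) = insert {m, opp m} ?R"
    unfolding tri_def hN l1 m(3) ch half_shift2 by blast
  have hc: "half c l = (\<lambda>(p, q). {p, q}) ` edges c l" "half m r = (\<lambda>(p, q). {p, q}) ` edges m r"
    unfolding half_def by (rule image_cong; use lt c m in \<open>force simp: chord_def\<close>)+
  have n1: "{c, c + N} \<notin> half c l" "{c, c + N} \<notin> half m r"
    unfolding hc using lt m by (fastforce simp: doubleton_eq_iff)+
  have n2: "{c, c + N} \<notin> half (c + N) l" "{c, c + N} \<notin> half (m + N) r"
    using opp_half_back[of "{c, c + N}" c l] opp_half_back[of "{c, c + N}" m r] n1 oc by (auto simp: insert_commute)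
  have "{opp c, opp (c + N)} = {c, c + N}" "{opp m, opp (opp m)} = {m, opp m}"
    using oc opp_opp[OF m(4)] by auto
  then show "tri m (Node r l) = exchange (tri c ?t) c (c + N) m (opp m)"
    unfolding exchange_def T T' using n1 n2 by auto
qed

lemma step_quad:
  assumes "step (c, t) (c', t')" "c < N" "leaves t = N"
  shows "\<exists>p q m k. quad (tri c t) p q m k \<and> tri c' t' = exchange (tri c t) p q m k"
  using assms(1)
proof cases
  case rot
  then obtain p q m k where sw: "switch (edges c t) (edges c t') p q m k" using rot_switch by blast
  have "leaves t' = N" using rot_leaves rot assms(3) by simp
  from switch_tri[OF assms(2,3) this sw] rot show ?thesis by blast
next
  case (diameter l r)
  then have "leaves (Node l r) = N" using assms(3) by simp
  from diameter_tri[OF assms(2) this] show ?thesis unfolding diameter by blast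
qed

lemma step_flip:
  assumes "step (c, t) (c', t')" "leaves t = N"
  shows "(tri c t, tri c' t') \<in> cyclohedron_graph d"
proof -
  \<comment> \<open>Both starting positions are lowered by the same multiple of N; this keeps the
    step and the triangulations and meets the requirement c < N of \<open>step_quad\<close>.\<close>
  have st: "step (c mod N, t) (c' - c + c mod N, t')" "tri (c' - c + c mod N) t' = tri c' t'"
  proof -
    have le: "c \<le> c'" using assms(1) by cases auto
    show "step (c mod N, t) (c' - c + c mod N, t')"
      using assms(1)
    proof cases
      case rot
      then show ?thesis using step.rot[of t t' "c mod N"] by simp
    next
      case (diameter l r)
      then show ?thesis using step.diameter[of "c mod N" l r] by (simp add: add.commute)
    qed
    have "tri (c' - c + c mod N) t' = tri (c' - c + c mod N + c div N * N) t'" by (rule tri_shifts[symmetric])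
    also have "c' - c + c mod N + c div N * N = c'" using le by (simp add: add.assoc)
    finally show "tri (c' - c + c mod N) t' = tri c' t'" .
  qed
  have cN: "c mod N < N" using N_pos by simp
  have t': "leaves t' = N" using step_leaves[OF assms(1)] assms(2) by simp
  obtain p q m k where "quad (tri (c mod N) t) p q m k"
    "tri c' t' = exchange (tri (c mod N) t) p q m k"
    using step_quad[OF st(1) cN assms(2)] unfolding st(2) by blast
  then have "flip d (tri c t) (tri c' t')" using quad_flip unfolding tri_mod by metis
  moreover have "tri c t \<in> cyclohedron_vertices d" "tri c' t' \<in> cyclohedron_vertices d"
    using tri_vertex[OF cN assms(2)] tri_vertex[of "c' mod N" t'] t' N_pos unfolding tri_mod by simp_all
  ultimately show ?thesis unfolding cyclohedron_graph_def by blast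
qed

lemma edge_step:
  assumes c: "c < N" and t: "leaves t = N"
    and h: "{x, x'} \<in> half c t" and cr: "crosses {x, x'} {y, y'}"
    and T: "{x, y} \<in> tri c t" "{y, x'} \<in> tri c t" "{x', y'} \<in> tri c t" "{y', x} \<in> tri c t"
  shows "\<exists>c' t'. step (c, t) (c', t') \<and> tri c' t' = exchange (tri c t) x x' y y'"
proof -
  obtain p q where pq: "{x, x'} = {p, q}" "(p, q) \<in> edges c t" "p < q" "c \<le> p" "q \<le> c + N"
    by (rule halfE[OF c t h])
  have "p < y \<and> y < q \<and> (y' < p \<or> q < y') \<or> p < y' \<and> y' < q \<and> (y < p \<or> q < y)"
    using cr pq(3) unfolding pq(1) by (auto simp: crosses_minmax min_def max_def split: if_splits)
  then obtain a b where ab: "{a, b} = {y, y'}" "p < a" "a < q" "b < p \<or> q < b" by auto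
  have side: "{p, a} \<in> tri c t" "{a, q} \<in> tri c t" "{p, b} \<in> tri c t" "{q, b} \<in> tri c t"
    using T pq(1) ab(1) by (auto simp: doubleton_eq_iff insert_commute)
  have nc: "\<And>e f. e \<in> tri c t \<Longrightarrow> f \<in> tri c t \<Longrightarrow> \<not> crosses e f" by (rule tri_noncrossing[OF c t])
  have "\<exists>c' t' m k. step (c, t) (c', t') \<and> quad (tri c t) p q m k \<and> tri c' t' = exchange (tri c t) p q m k"
  proof (cases "(p, q) = (c, c + leaves t)")
    case True
    then obtain l r where "t = Node l r" using ab t by (cases t) auto
    then show ?thesis using diameter_tri[OF c, of l r] step.diameter[of c l r] True t by auto
  next
    case False
    have "p + 1 < q" using ab by linarith
    from switch_at_edge[OF pq(2) this False] obtain t' m k where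
      t': "rot t t'" "switch (edges c t) (edges c t') p q m k" by blast
    have "leaves t' = N" using rot_leaves[OF t'(1)] t by simp
    from switch_tri[OF c t this t'(2)] step.rot[OF t'(1), of c] show ?thesis by blast
  qed
  then obtain c' t' m k where s: "step (c, t) (c', t')" "quad (tri c t) p q m k"
    "tri c' t' = exchange (tri c t) p q m k" by blast
  have "a = m" "b = k" using quad_unique[OF nc s(2) ab(2,3) side(1,2) ab(4) side(3,4)] by blast+
  moreover have "{opp x, opp x'} = {opp p, opp q}" "{opp a, opp b} = {opp y, opp y'}"
    using pq(1) ab(1) by (auto simp: doubleton_eq_iff)
  ultimately have "exchange (tri c t) x x' y y' = exchange (tri c t) p q m k"
    unfolding exchange_def pq(1) using ab(1) by simp
  with s show ?thesis by metis
qed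

lemma flip_step:
  assumes "flip d (tri c t) U" "leaves t = N"
  shows "\<exists>c' t'. step (c mod N, t) (c', t') \<and> U = tri c' t'"
proof -
  let ?c = "c mod N"
  have c: "?c < N" using N_pos by simp
  obtain x x' y y' where f: "{x, x'} \<in> tri ?c t" "{x, y} \<in> tri ?c t" "{y, x'} \<in> tri ?c t" "{x', y'} \<in> tri ?c t"
      "{y', x} \<in> tri ?c t" "crosses {x, x'} {y, y'}" "U = exchange (tri ?c t) x x' y y'"
    using assms(1) unfolding flip_def exchange_def tri_mod by blast
  from f(1) consider "{x, x'} \<in> half ?c t" | "{x, x'} \<in> half (?c + N) t" unfolding tri_def by blast
  then show ?thesis
  proof cases
    case 1
    from edge_step[OF c assms(2) 1 f(6) f(2-5)] f(7) show ?thesis by metis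
  next
    \<comment> \<open>\<open>flip\<close> may name the copy of the edge in the other half. The half
      turn moves it into the half of the tree and leaves the resulting triangulation
      unchanged.\<close>
    case 2
    have l: "{x, x'} \<subseteq> {..<2 * N}" "{y, y'} \<subseteq> {..<2 * N}"
      using tri_less[OF f(2)] tri_less[OF f(4)] by auto
    have o: "{opp x, opp x'} \<in> half ?c t" using opp_half_back[OF 2] by simp
    have cr: "crosses {opp x, opp x'} {opp y, opp y'}" using crosses_opp[OF f(6) l] by simp
    have T: "{opp x, opp y} \<in> tri ?c t" "{opp y, opp x'} \<in> tri ?c t" "{opp x', opp y'} \<in> tri ?c t"
      "{opp y', opp x} \<in> tri ?c t"
      using f(2-5)[THEN opp_tri] by simp_all
    have "exchange (tri ?c t) (opp x) (opp x') (opp y) (opp y') = U"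
      unfolding f(7) exchange_def using l by (simp add: opp_opp insert_commute)
    with edge_step[OF c assms(2) o cr T] show ?thesis by metis
  qed
qed

end

section \<open>The upper bound\<close>

definition reach :: "'a rel \<Rightarrow> nat \<Rightarrow> 'a \<Rightarrow> 'a \<Rightarrow> bool" where
  "reach R k x y \<longleftrightarrow> (\<exists>j\<le>k. (x, y) \<in> R ^^ j)"

lemma reach_refl: "reach R k x x"
  unfolding reach_def by (intro exI[of _ 0]) simp

lemma reach_step: "(x, y) \<in> R \<Longrightarrow> reach R (Suc 0) x y"
  unfolding reach_def by (intro exI[of _ 1]) simp

lemma reach_trans: "reach R a x y \<Longrightarrow> reach R b y z \<Longrightarrow> reach R (a + b) x z"
  unfolding reach_def by (metis add_mono relcompI relpow_add)

lemma reach_mono: "reach R a x y \<Longrightarrow> a \<le> b \<Longrightarrow> reach R b x y"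
  unfolding reach_def by (meson le_trans)

lemma reach_map:
  assumes "reach R k x y" "\<And>x y. (x, y) \<in> R \<Longrightarrow> P x \<Longrightarrow> (f x, f y) \<in> S \<and> P y" "P x"
  shows "reach S k (f x) (f y)"
proof -
  obtain j where j: "j \<le> k" "(x, y) \<in> R ^^ j" using assms(1) unfolding reach_def by blast
  have "(f x, f y) \<in> S ^^ j \<and> P y" using j(2)
  proof (induction j arbitrary: y)
    case (Suc j)
    then obtain z where "(x, z) \<in> R ^^ j" "(z, y) \<in> R" by auto
    with Suc.IH[of z] assms(2)[of z y] show ?case by auto
  qed (use assms(3) in simp)
  then show ?thesis using j(1) unfolding reach_def by blast
qed

lemma reach_weaken: "reach R a x y \<Longrightarrow> a \<le> b \<Longrightarrow> y = z \<Longrightarrow> reach R b x z"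
  using reach_mono by fast

lemma reach_sym:
  assumes "reach R k x y" "sym R" shows "reach R k y x"
proof -
  obtain j where j: "j \<le> k" "(x, y) \<in> R ^^ j" using assms(1) unfolding reach_def by blast
  have "(y, x) \<in> R ^^ j" using j(2)
  proof (induction j arbitrary: y)
    case (Suc j)
    then obtain z where "(x, z) \<in> R ^^ j" "(z, y) \<in> R" by auto
    then show ?case using Suc.IH[of z] symD[OF assms(2)] by (blast intro: relpow_Suc_I2)
  qed simp
  then show ?thesis using j(1) unfolding reach_def by blast
qed

section \<open>Rotating trees into fans and cones\<close>

abbreviation rotations :: "nat \<Rightarrow> tree \<Rightarrow> tree \<Rightarrow> bool" where
  "rotations \<equiv> reach {(s, t). rot s t}"

lemma rotations_left: "rotations k l l' \<Longrightarrow> rotations k (Node l r) (Node l' r)"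
  by (rule reach_map[where P = "\<lambda>_. True" and f = "\<lambda>l. Node l r"]) (auto intro: rot.in_left)

lemma rotations_right: "rotations k r r' \<Longrightarrow> rotations k (Node l r) (Node l r')"
  by (rule reach_map[where P = "\<lambda>_. True" and f = "\<lambda>r. Node l r"]) (auto intro: rot.in_right)

lemma rotations_rot: "rot s t \<Longrightarrow> rotations (Suc 0) s t"
  by (rule reach_step) simp

text \<open>The fan whose chords all start at the left end of the arc; \<open>rcomb\<close> is the
  fan at the right end. Hence \<open>Node (rcomb a) (lcomb b)\<close> is the cone from its middle
  point.\<close>

fun lcomb :: "nat \<Rightarrow> tree" where
  "lcomb 0 = Leaf"
| "lcomb (Suc k) = Node (lcomb k) Leaf"

fun rcomb :: "nat \<Rightarrow> tree" where
  "rcomb 0 = Leaf"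
| "rcomb (Suc k) = Node Leaf (rcomb k)"

lemma leaves_lcomb [simp]: "leaves (lcomb k) = Suc k"
  by (induction k) auto

lemma leaves_rcomb [simp]: "leaves (rcomb k) = Suc k"
  by (induction k) auto

text \<open>One rotation for each inner node of \<open>r\<close>: rotating at the root brings the
  apex of \<open>r\<close> to the fan, and the two subtrees of \<open>r\<close> are then absorbed in
  turn.\<close>

lemma graft_lcomb: "rotations (leaves r - 1) (Node (lcomb b) r) (lcomb (b + leaves r))"
proof (induction r arbitrary: b)
  case Leaf
  then show ?case by (simp add: reach_refl)
next
  case (Node r1 r2)
  have "rotations (Suc 0) (Node (lcomb b) (Node r1 r2)) (Node (Node (lcomb b) r1) r2)"
    by (rule rotations_rot) (rule rot.left)
  note reached = reach_trans[OF reach_trans[OF this rotations_left[OF Node.IH(1)[of b]]] Node.IH(2)]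
  show ?case
    by (rule reach_weaken[OF reached]; (rule arg_cong[where f = lcomb] arg_cong[where f = rcomb])?;
        insert leaves_pos[of r1] leaves_pos[of r2]; unfold leaves.simps; linarith)
qed

lemma graft_rcomb: "rotations (leaves l - 1) (Node l (rcomb b)) (rcomb (b + leaves l))"
proof (induction l arbitrary: b)
  case Leaf
  then show ?case by (simp add: reach_refl)
next
  case (Node l1 l2)
  have "rotations (Suc 0) (Node (Node l1 l2) (rcomb b)) (Node l1 (Node l2 (rcomb b)))"
    by (rule rotations_rot) (rule rot.right)
  note reached = reach_trans[OF reach_trans[OF this rotations_right[OF Node.IH(2)[of b]]] Node.IH(1)]
  show ?case
    by (rule reach_weaken[OF reached]; (rule arg_cong[where f = lcomb] arg_cong[where f = rcomb])?;
        insert leaves_pos[of l1] leaves_pos[of l2]; unfold leaves.simps; linarith)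
qed

lemma to_lcomb: "rotations (leaves t - 1) t (lcomb (leaves t - 1))"
proof (induction t)
  case Leaf
  then show ?case by (simp add: reach_refl)
next
  case (Node l r)
  note reached = reach_trans[OF rotations_left[OF Node.IH(1), of r] graft_lcomb[of r "leaves l - 1"]]
  show ?case
    by (rule reach_weaken[OF reached]; (rule arg_cong[where f = lcomb] arg_cong[where f = rcomb])?;
        insert leaves_pos[of l] leaves_pos[of r]; unfold leaves.simps; linarith)
qed

lemma to_rcomb: "rotations (leaves t - 1) t (rcomb (leaves t - 1))"
proof (induction t)
  case Leaf
  then show ?case by (simp add: reach_refl)
next
  case (Node l r)
  note reached = reach_trans[OF rotations_right[OF Node.IH(2), of l] graft_rcomb[of l "leaves r - 1"]]
  show ?case
    by (rule reach_weaken[OF reached]; (rule arg_cong[where f = lcomb] arg_cong[where f = rcomb])?;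
        insert leaves_pos[of l] leaves_pos[of r]; unfold leaves.simps; linarith)
qed

text \<open>If the root splits at the wanted apex, both sides become fans. Otherwise the apex lies
  inside one subtree: cone that subtree, rotate once to bring its apex to the root, and graft the
  other subtree. The counts add up to a + b + 1 in these two cases.\<close>

lemma to_cone:
  assumes "leaves t = a + b + 2"
  shows "rotations (a + b + 1) t (Node (rcomb a) (lcomb b))"
  using assms
proof (induction t arbitrary: a b)
  case Leaf
  then show ?case by simp
next
  case (Node l r)
  have pos: "0 < leaves l" "0 < leaves r" by auto
  consider "leaves l = a + 1" | "a + 1 < leaves l" | "leaves l < a + 1" by linarith
  then show ?case
  proof cases
    case 1
    then have r: "leaves r = b + 1" using Node.prems by simp
    have "rotations (a + b) (Node l r) (Node (rcomb a) (lcomb b))"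
      using reach_trans[OF rotations_left[OF to_rcomb[of l], of r] rotations_right[OF to_lcomb[of r]]] 1 r
      by simp
    then show ?thesis by (rule reach_mono) simp
  next
    case 2
    define b' where "b' = leaves l - a - 2"
    have l: "leaves l = a + b' + 2" using 2 unfolding b'_def by simp
    have b: "b' + leaves r = b" using l Node.prems by simp
    have "rotations (Suc 0) (Node (Node (rcomb a) (lcomb b')) r) (Node (rcomb a) (Node (lcomb b') r))"
      by (rule rotations_rot) (rule rot.right)
    from reach_trans[OF reach_trans[OF rotations_left[OF Node.IH(1)[OF l]] this]
        rotations_right[OF graft_lcomb[of r b']]]
    show ?thesis unfolding b by (rule reach_mono) (use l b pos in linarith)
  next
    case 3
    define a' where "a' = a - leaves l"
    have r: "leaves r = a' + b + 2" and a: "a' + leaves l = a" using 3 Node.prems unfolding a'_def by auto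
    have "rotations (Suc 0) (Node l (Node (rcomb a') (lcomb b))) (Node (Node l (rcomb a')) (lcomb b))"
      by (rule rotations_rot) (rule rot.left)
    from reach_trans[OF reach_trans[OF rotations_right[OF Node.IH(2)[OF r]] this]
        rotations_left[OF graft_rcomb[of l a']]]
    show ?thesis unfolding a by (rule reach_mono) (use r a pos in linarith)
  qed
qed

text \<open>The diameter stays fixed and its two endpoints carry a fan each; every rotation moves
  the common point of the fans by one position.\<close>

lemma slide: "rotations k (Node (lcomb b) (rcomb (a + k))) (Node (lcomb (b + k)) (rcomb a))"
proof (induction k arbitrary: b)
  case 0
  then show ?case by (simp add: reach_refl)
next
  case (Suc k)
  have "rotations (Suc 0) (Node (lcomb b) (rcomb (a + Suc k))) (Node (lcomb (Suc b)) (rcomb (a + k)))"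
    using rotations_rot[OF rot.left[of "lcomb b" Leaf "rcomb (a + k)"]] by simp
  from reach_trans[OF this Suc.IH[of "Suc b"]] show ?case by simp
qed

context polygon
begin

abbreviation flips :: "nat \<Rightarrow> nat set set \<Rightarrow> nat set set \<Rightarrow> bool" where
  "flips \<equiv> reach (cyclohedron_graph d)"

lemma graph_sym: "sym (cyclohedron_graph d)"
proof (rule symI)
  fix T U assume TU: "(T, U) \<in> cyclohedron_graph d"
  then have T: "T \<in> cyclohedron_vertices d" "flip d T U" unfolding cyclohedron_graph_def by blast+
  from vertex_tri[OF T(1)] obtain c t where t: "c < N" "leaves t = N" "T = tri c t" by blast
  from flip_step[of c t U] T(2) t obtain c' t' where s: "step (c, t) (c', t')" "U = tri c' t'" by auto
  have t': "leaves t' = N" using step_leaves[OF s(1)] t by simp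
  from s(1) show "(U, T) \<in> cyclohedron_graph d"
  proof cases
    case rot
    then show ?thesis using step_flip[OF step.rot[OF rot_sym] t'] s t by blast
  next
    case (diameter l r)
    have "step (c', Node r l) (c' + leaves r, Node l r)" by (rule step.diameter)
    from step_flip[OF this] have "(tri c' t', tri (c' + leaves r) t) \<in> cyclohedron_graph d"
      using t' diameter by simp
    moreover have "c' + leaves r = c + N" using diameter t by simp
    ultimately show ?thesis using s(2) t(3) tri_shift by simp
  qed
qed

lemma rotations_flips:
  assumes "rotations k t t'" "leaves t = N" shows "flips k (tri c t) (tri c t')"
  by (rule reach_map[OF assms(1), where P = "\<lambda>t. leaves t = N"])
    (use step_flip[OF step.rot] rot_leaves assms(2) in auto)

text \<open>At most N - 1 rotations cone the half from c + a + 1, and one more flip moves the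
  diameter there. Afterwards the two fans meet at the old endpoint c + N.\<close>

lemma to_split:
  assumes "leaves t = N" "a + b + 2 = N"
  shows "flips N (tri c t) (tri (c + a + 1) (Node (lcomb b) (rcomb a)))"
proof -
  have "flips (a + b + 1) (tri c t) (tri c (Node (rcomb a) (lcomb b)))"
    by (rule rotations_flips[OF to_cone]) (use assms in simp_all)
  moreover have "flips (Suc 0) (tri c (Node (rcomb a) (lcomb b))) (tri (c + a + 1) (Node (lcomb b) (rcomb a)))"
    using step_flip[OF step.diameter[of c "rcomb a" "lcomb b"]] assms(2) by (intro reach_step) simp
  ultimately have "flips (a + b + 1 + Suc 0) (tri c t) (tri (c + a + 1) (Node (lcomb b) (rcomb a)))"
    by (rule reach_trans)
  then show ?thesis by (rule reach_mono) (use assms(2) in simp)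
qed

lemma slide_flips:
  assumes "a + b + k + 2 = N"
  shows "flips k (tri c (Node (lcomb b) (rcomb (a + k)))) (tri c (Node (lcomb (b + k)) (rcomb a)))"
  by (rule rotations_flips[OF slide]) (use assms in simp)

text \<open>Both triangulations are coned from the same vertex \<open>x\<close> and the diameter is flipped to
  \<open>x\<close>; the two results differ by sliding the apex of the diameter along one of the two
  arcs between the original diameters, whichever is shorter.\<close>

lemma flips_bound_aux:
  assumes N4: "4 \<le> N" and t: "leaves t1 = N" "leaves t2 = N" and c: "c1 \<le> c2" "c2 < N"
  shows "flips (2 * N + N div 2) (tri c1 t1) (tri c2 t2)"
proof -
  define k where "k = c2 - c1"
  show ?thesis
  proof (cases "k \<le> N div 2")
    case True
    \<comment> \<open>No truncation occurs: k is at most N div 2 and N is at least 4.\<close>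
    define b where "b = N - k - 2"
    have b: "0 + b + k + 2 = N" using True N4 unfolding b_def by linarith
    have "flips N (tri c1 t1) (tri (c1 + k + 1) (Node (lcomb b) (rcomb k)))"
      by (rule to_split[OF t(1)]) (use b in simp)
    moreover have "c1 + k + 1 = c2 + 1" using c unfolding k_def by simp
    moreover have "flips N (tri c2 t2) (tri (c2 + 1) (Node (lcomb (b + k)) (rcomb 0)))"
      using to_split[OF t(2), of 0 "b + k" c2] b by simp
    moreover have "flips k (tri (c2 + 1) (Node (lcomb b) (rcomb k))) (tri (c2 + 1) (Node (lcomb (b + k)) (rcomb 0)))"
      using slide_flips[OF b] by simp
    ultimately have "flips (N + k + N) (tri c1 t1) (tri c2 t2)"
      using reach_trans reach_sym[OF _ graph_sym] by metis
    then show ?thesis by (rule reach_mono) (use True in simp)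
  next
    case False
    define j where "j = N - k"
    define b where "b = N - j - 2"
    have j: "j \<le> N div 2" using False unfolding j_def by linarith
    have b: "0 + b + j + 2 = N" using j N4 unfolding b_def by linarith
    have "flips N (tri c2 t2) (tri (c2 + j + 1) (Node (lcomb b) (rcomb j)))"
      by (rule to_split[OF t(2)]) (use b in simp)
    moreover have "c2 + j + 1 = c1 + 1 + N" using c unfolding k_def j_def by simp
    moreover have "flips N (tri c1 t1) (tri (c1 + 1) (Node (lcomb (b + j)) (rcomb 0)))"
      using to_split[OF t(1), of 0 "b + j" c1] b by simp
    moreover have "flips j (tri (c1 + 1) (Node (lcomb b) (rcomb j))) (tri (c1 + 1) (Node (lcomb (b + j)) (rcomb 0)))"
      using slide_flips[OF b] by simp
    ultimately have "flips (N + j + N) (tri c2 t2) (tri c1 t1)"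
      using reach_trans reach_sym[OF _ graph_sym] tri_shift by metis
    then have "flips (N + j + N) (tri c1 t1) (tri c2 t2)" by (rule reach_sym[OF _ graph_sym])
    then show ?thesis by (rule reach_mono) (use j in simp)
  qed
qed

lemma flips_bound:
  assumes N4: "4 \<le> N" and T: "T \<in> cyclohedron_vertices d" "U \<in> cyclohedron_vertices d"
  shows "flips (2 * N + N div 2) T U"
proof -
  from vertex_tri[OF T(1)] obtain c1 t1 where 1: "c1 < N" "leaves t1 = N" "T = tri c1 t1" by blast
  from vertex_tri[OF T(2)] obtain c2 t2 where 2: "c2 < N" "leaves t2 = N" "U = tri c2 t2" by blast
  show ?thesis
  proof (cases "c1 \<le> c2")
    case True
    then show ?thesis using flips_bound_aux[OF N4 1(2) 2(2)] 1 2 by blast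
  next
    case False
    then show ?thesis using reach_sym[OF flips_bound_aux[OF N4 2(2) 1(2)] graph_sym] 1 2 by simp
  qed
qed

lemma diameter_upper:
  assumes "4 \<le> N" shows "cyclohedron_diameter d \<le> enat (2 * N + N div 2)"
  unfolding cyclohedron_diameter_def graph_diameter_def
proof (intro SUP_least)
  fix T U assume "T \<in> cyclohedron_vertices d" "U \<in> cyclohedron_vertices d"
  from flips_bound[OF assms this] obtain j where "j \<le> 2 * N + N div 2" "(T, U) \<in> cyclohedron_graph d ^^ j"
    unfolding reach_def by blast
  then show "graph_dist (cyclohedron_graph d) T U \<le> enat (2 * N + N div 2)"
    unfolding graph_dist_def by (intro INF_lower2[of j]) auto
qed

end

section \<open>A potential for the lower bound\<close>

text \<open>The positions \<open>0, 1, 2, \<dots>\<close> along the (periodically continued) boundary are split into blocks,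
  two per half turn, and each block into cells.  A label \<open>(j, x, a)\<close> means the position with
  offset \<open>a\<close> in cell \<open>x\<close> of block \<open>j\<close>.  Cells and offsets are counted forwards in even blocks and
  backwards in odd ones, so that a zigzag between two neighbouring blocks joins equal cells.\<close>

type_synonym label = "int \<times> int \<times> int"

fun prec :: "label \<Rightarrow> label \<Rightarrow> bool" where
  "prec (j, x, a) (k, y, b) \<longleftrightarrow>
     j < k \<or> j = k \<and> (if even j then x < y \<or> x = y \<and> a < b else y < x \<or> y = x \<and> b < a)"

fun turn :: "label \<Rightarrow> label" where
  "turn (j, x, a) = (j + 2, x, a)"

text \<open>Weight of a triangle whose first vertex is in an even block; \<open>weightB\<close>
  serves odd blocks. \<open>k\<close> and \<open>l\<close> are the blocks of the other two vertices
  relative to the first, at most 2 inside a half turn; \<open>x\<close>, \<open>y\<close>,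
  \<open>z\<close> are the cells and \<open>a\<close>, \<open>b\<close>, \<open>c\<close> the
  offsets. Only the zigzag values (-3, -2 here and 2, 3 in \<open>weightB\<close>) enter the leading
  term; the rest must satisfy the local inequalities and be bounded.\<close>

definition weightA :: "int \<Rightarrow> int \<Rightarrow> int \<Rightarrow> int \<Rightarrow> int \<Rightarrow> int \<Rightarrow> int \<Rightarrow> int \<Rightarrow> int" where
  "weightA k l x a y b z c =
    (if k = 0 then
       if l = 0 \<or> x \<noteq> y then 0
       else if l = 1 then if z < x \<or> z = x \<and> c \<le> b then -2 else if z = x then -1 else 0
       else if z = x \<and> c = a then -1 else -2
     else if k = 1 then
       if l = 1 then
         (if y = z then -1 else 0)
         + (if x = y \<and> y = z then if a < b \<and> c < a then -1 else if a = b then -2 else 0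
            else if x = y \<and> b < a then 2 else 0)
       else if z = x \<and> c = a then
         (if y = x \<and> b < a then 1 else 0) - (if y = z + 1 \<and> c < b then 1 else 0)
       else if z = x then
         if y = x then if b < a then 1 else -1 else if y = z + 1 then if c < b then -1 else 1 else 0
       else (if y = x \<and> b < a then 2 else 0) - (if y = z + 1 \<and> c < b then 2 else 0)
     else if y \<noteq> z then 0 else if z = x \<and> c = a then 1 else 2)"

definition weightB :: "int \<Rightarrow> int \<Rightarrow> int \<Rightarrow> int \<Rightarrow> int \<Rightarrow> int \<Rightarrow> int \<Rightarrow> int \<Rightarrow> int" where
  "weightB k l x a y b z c =
    (if k = 0 then
       if l = 0 then (if x = y then 1 else 0) - (if y = z then 1 else 0)
       else if l = 1 then
         (if x = y then 1 else 0)
         + (if y \<noteq> z + 1 then 0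
            else if x = y then if b < c \<and> c < a then 1 else if b = c then 2 else 0
            else if c < b then -2 else 0)
       else if x = y then 1 else 0
     else if k = 1 then
       if l = 2 \<or> y \<noteq> z then 0
       else if y + 1 < x \<or> x = y + 1 \<and> b \<le> a then 2 else if x = y + 1 then 1 else 0
     else if y = z then -1 else 0)"

fun weight :: "label \<Rightarrow> label \<Rightarrow> label \<Rightarrow> int" where
  "weight (j, x, a) (k, y, b) (l, z, c) =
     (if even j then weightA else weightB) (k - j) (l - j) x a y b z c"

text \<open>Corrections for the root triangles of the left subtree (\<open>rho1\<close>) and of the
  right subtree (\<open>rho2\<close>). Their supports reflect the two kinds of zigzag: equal cells
  from an even block to the next, and cells differing by one from an odd block to the next.\<close>

fun rho1 :: "label \<Rightarrow> label \<Rightarrow> label \<Rightarrow> int" where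
  "rho1 (j, x, a) (k, y, b) (l, z, c) =
     (if even j \<and> k = j + 1 \<and> l = j + 1 \<and> x = y \<and> y = z \<and> b \<le> a then 1 else 0)"

fun rho2 :: "label \<Rightarrow> label \<Rightarrow> label \<Rightarrow> int" where
  "rho2 (j, x, a) (k, y, b) (l, z, c) =
     (if even l \<and> j = l - 1 \<and> k = l - 1 \<and> x = z + 1 \<and> y = z + 1 \<and> c \<le> b then -1 else 0)"

text \<open>What a nonzero correction reveals about the outer side of its triangle alone. It allows
  bounds in which the third vertex of a neighbouring triangle is unknown.\<close>

fun kappa1 :: "label \<Rightarrow> label \<Rightarrow> bool" where
  "kappa1 (j, x, a) (k, y, b) \<longleftrightarrow> even j \<and> k = j + 1 \<and> x = y \<and> b < a"

fun kappa2 :: "label \<Rightarrow> label \<Rightarrow> bool" where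
  "kappa2 (j, x, a) (k, y, b) \<longleftrightarrow> even k \<and> j = k - 1 \<and> x = y + 1 \<and> b < a"

text \<open>The change of the weight sum when the diagonal \<open>p r\<close> of the quadrilateral
  replaces \<open>q s\<close>.\<close>

definition swap :: "label \<Rightarrow> label \<Rightarrow> label \<Rightarrow> label \<Rightarrow> int" where
  "swap p q r s = weight p q r + weight p r s - weight p q s - weight q r s"


section \<open>The local inequalities, by finite case analysis on labels\<close>

lemma rho1_cases: "prec p r \<Longrightarrow> prec r q \<Longrightarrow> rho1 p r q = 0 \<or> rho1 p r q = 1 \<and> kappa1 p q"
  by (cases p; cases q; cases r) (auto split: if_splits)

lemma rho2_cases: "prec p r \<Longrightarrow> prec r q \<Longrightarrow> rho2 p r q = 0 \<or> rho2 p r q = -1 \<and> kappa2 p q"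
  by (cases p; cases q; cases r) (auto split: if_splits)

lemma block_le: "prec (j, x, a) (k, y, b) \<Longrightarrow> j \<le> k"
  by auto

text \<open>Four ordered positions within a half turn span at most two further blocks, which leaves
  ten patterns of relative blocks.\<close>

lemma four_cases:
  assumes "prec p q" "prec q r" "prec r s" "prec s (turn p)"
  obtains j x a k y b l z c m u e where
    "p = (j, x, a)" "q = (j + k, y, b)" "r = (j + l, z, c)" "s = (j + m, u, e)"
    "(k, l, m) \<in> {(0,0,0),(0,0,1),(0,0,2),(0,1,1),(0,1,2),(0,2,2),(1,1,1),(1,1,2),(1,2,2),(2,2,2)}"
proof -
  obtain j x a k y b l z c m u e where e: "p = (j, x, a)" "q = (k, y, b)" "r = (l, z, c)" "s = (m, u, e)"
    by (metis prod_cases3)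
  have "j \<le> k" "k \<le> l" "l \<le> m" "m \<le> j + 2"
    using assms unfolding e turn.simps by (blast dest: block_le)+
  then have "(k - j, l - j, m - j) \<in> {(0,0,0),(0,0,1),(0,0,2),(0,1,1),(0,1,2),(0,2,2),(1,1,1),(1,1,2),(1,2,2),(2,2,2)}"
    by simp arith
  then show ?thesis using e by (intro that[of j x a "k - j" y b "l - j" z c "m - j" u e]) auto
qed

lemma three_cases:
  assumes "prec p q" "prec q r" "prec r (turn p)"
  obtains j x a k y b l z c where
    "p = (j, x, a)" "q = (j + k, y, b)" "r = (j + l, z, c)"
    "(k, l) \<in> {(0,0),(0,1),(0,2),(1,1),(1,2),(2,2)}"
proof -
  obtain j x a k y b l z c where e: "p = (j, x, a)" "q = (k, y, b)" "r = (l, z, c)"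
    by (metis prod_cases3)
  have "j \<le> k" "k \<le> l" "l \<le> j + 2"
    using assms unfolding e turn.simps by (blast dest: block_le)+
  then have "(k - j, l - j) \<in> {(0,0),(0,1),(0,2),(1,1),(1,2),(2,2)}"
    by simp arith
  then show ?thesis using e by (intro that[of j x a "k - j" y b "l - j" z c]) auto
qed

text \<open>For each block pattern the order hypotheses become disjunctions of comparisons of cells
  and offsets. The weights stay folded until these are split, so that few branches of their
  definitions survive in each case. The companion lemmas below follow the same scheme.\<close>

lemma swap_bound_even:
  assumes "prec p q" "prec q r" "prec r s" "prec s (turn p)" "even (fst p)"
  shows "swap p q r s \<in> {-2..2}"
  using assms(1-4)
proof (cases rule: four_cases)
  case (1 j x a k y b l z c m u e)
  have par: "even j" using assms(5) 1 by simp
  note ord = assms(1-4)[unfolded 1]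
  show ?thesis using 1(5) ord unfolding 1(1-4)
    by (elim insertE emptyE Pair_inject; hypsubst; simp only: turn.simps)
      (simp_all add: par swap_def del: atLeastAtMost_iff weight.simps rho1.simps rho2.simps,
       (elim disjE conjE; (hypsubst)?; simp add: par weightA_def weightB_def split: if_split)+)
qed

lemma swap_bound_odd:
  assumes "prec p q" "prec q r" "prec r s" "prec s (turn p)" "odd (fst p)"
  shows "swap p q r s \<in> {-2..2}"
  using assms(1-4)
proof (cases rule: four_cases)
  case (1 j x a k y b l z c m u e)
  have par: "odd j" using assms(5) 1 by simp
  note ord = assms(1-4)[unfolded 1]
  show ?thesis using 1(5) ord unfolding 1(1-4)
    by (elim insertE emptyE Pair_inject; hypsubst; simp only: turn.simps)
      (simp_all add: par swap_def del: atLeastAtMost_iff weight.simps rho1.simps rho2.simps,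
       (elim disjE conjE; (hypsubst)?; simp add: par weightA_def weightB_def split: if_split)+)
qed

lemma swap_bound_rho1_even:
  assumes "prec p q" "prec q r" "prec r s" "prec s (turn p)" "even (fst p)"
  shows "swap p q r s + rho1 p r s - rho1 p q s \<in> {-2..2}"
  using assms(1-4)
proof (cases rule: four_cases)
  case (1 j x a k y b l z c m u e)
  have par: "even j" using assms(5) 1 by simp
  note ord = assms(1-4)[unfolded 1]
  show ?thesis using 1(5) ord unfolding 1(1-4)
    by (elim insertE emptyE Pair_inject; hypsubst; simp only: turn.simps)
      (simp_all add: par swap_def del: atLeastAtMost_iff weight.simps rho1.simps rho2.simps,
       (elim disjE conjE; (hypsubst)?; simp add: par weightA_def weightB_def split: if_split)+)
qed

lemma swap_bound_rho1_odd:
  assumes "prec p q" "prec q r" "prec r s" "prec s (turn p)" "odd (fst p)"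
  shows "swap p q r s + rho1 p r s - rho1 p q s \<in> {-2..2}"
  using assms(1-4)
proof (cases rule: four_cases)
  case (1 j x a k y b l z c m u e)
  have par: "odd j" using assms(5) 1 by simp
  note ord = assms(1-4)[unfolded 1]
  show ?thesis using 1(5) ord unfolding 1(1-4)
    by (elim insertE emptyE Pair_inject; hypsubst; simp only: turn.simps)
      (simp_all add: par swap_def del: atLeastAtMost_iff weight.simps rho1.simps rho2.simps,
       (elim disjE conjE; (hypsubst)?; simp add: par weightA_def weightB_def split: if_split)+)
qed

lemma swap_bound_rho2_even:
  assumes "prec p q" "prec q r" "prec r s" "prec s (turn p)" "even (fst p)"
  shows "swap p q r s + rho2 p r s - rho2 p q s \<in> {-2..2}"
  using assms(1-4)
proof (cases rule: four_cases)
  case (1 j x a k y b l z c m u e)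
  have par: "even j" using assms(5) 1 by simp
  note ord = assms(1-4)[unfolded 1]
  show ?thesis using 1(5) ord unfolding 1(1-4)
    by (elim insertE emptyE Pair_inject; hypsubst; simp only: turn.simps)
      (simp_all add: par swap_def del: atLeastAtMost_iff weight.simps rho1.simps rho2.simps,
       (elim disjE conjE; (hypsubst)?; simp add: par weightA_def weightB_def split: if_split)+)
qed

lemma swap_bound_rho2_odd:
  assumes "prec p q" "prec q r" "prec r s" "prec s (turn p)" "odd (fst p)"
  shows "swap p q r s + rho2 p r s - rho2 p q s \<in> {-2..2}"
  using assms(1-4)
proof (cases rule: four_cases)
  case (1 j x a k y b l z c m u e)
  have par: "odd j" using assms(5) 1 by simp
  note ord = assms(1-4)[unfolded 1]
  show ?thesis using 1(5) ord unfolding 1(1-4)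
    by (elim insertE emptyE Pair_inject; hypsubst; simp only: turn.simps)
      (simp_all add: par swap_def del: atLeastAtMost_iff weight.simps rho1.simps rho2.simps,
       (elim disjE conjE; (hypsubst)?; simp add: par weightA_def weightB_def split: if_split)+)
qed


lemma swap_bound:
  assumes "prec p q" "prec q r" "prec r s" "prec s (turn p)"
  shows "\<bar>swap p q r s\<bar> \<le> 2"
  using swap_bound_even[OF assms] swap_bound_odd[OF assms] by (cases "even (fst p)") (auto simp: abs_le_iff)

lemma swap_bound_rho1:
  assumes "prec p q" "prec q r" "prec r s" "prec s (turn p)"
  shows "\<bar>swap p q r s + rho1 p r s - rho1 p q s\<bar> \<le> 2"
  using swap_bound_rho1_even[OF assms] swap_bound_rho1_odd[OF assms] by (cases "even (fst p)") (auto simp: abs_le_iff)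

lemma swap_bound_rho2:
  assumes "prec p q" "prec q r" "prec r s" "prec s (turn p)"
  shows "\<bar>swap p q r s + rho2 p r s - rho2 p q s\<bar> \<le> 2"
  using swap_bound_rho2_even[OF assms] swap_bound_rho2_odd[OF assms] by (cases "even (fst p)") (auto simp: abs_le_iff)

text \<open>Rotation at the root, where the fourth corner is the half turn of the first. The inner
  triangle with corners p, q, r carries \<open>rho1\<close> on one side of the rotation, the one
  with corners q, r, \<open>turn p\<close> carries \<open>rho2\<close> on the other;
  \<open>e\<close> and \<open>f\<close> are the corrections of the outer subtrees, known only
  through \<open>kappa1\<close> and \<open>kappa2\<close>.\<close>

lemma top_bound_even:
  assumes "prec p q" "prec q r" "prec r (turn p)" "even (fst p)"
    "e = 0 \<or> e = 1 \<and> kappa1 p q" "f = 0 \<or> f = -1 \<and> kappa2 r (turn p)"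
  shows "swap p q r (turn p) + rho1 p q r + f - e - rho2 q r (turn p) \<in> {-2..2}"
  using assms(1-3)
proof (cases rule: three_cases)
  case (1 j x a k y b l z c)
  have par: "even j" using assms(4) 1 by simp
  note ord = assms(1-3,5,6)[unfolded 1]
  show ?thesis using 1(4) ord unfolding 1(1-3)
    by (elim insertE emptyE Pair_inject; hypsubst; simp only: turn.simps)
      (simp_all add: par swap_def del: atLeastAtMost_iff weight.simps rho1.simps rho2.simps,
       (elim disjE conjE; (hypsubst)?; simp add: par weightA_def weightB_def split: if_split)+)
qed

lemma top_bound_odd:
  assumes "prec p q" "prec q r" "prec r (turn p)" "odd (fst p)"
    "e = 0 \<or> e = 1 \<and> kappa1 p q" "f = 0 \<or> f = -1 \<and> kappa2 r (turn p)"
  shows "swap p q r (turn p) + rho1 p q r + f - e - rho2 q r (turn p) \<in> {-2..2}"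
  using assms(1-3)
proof (cases rule: three_cases)
  case (1 j x a k y b l z c)
  have par: "odd j" using assms(4) 1 by simp
  note ord = assms(1-3,5,6)[unfolded 1]
  show ?thesis using 1(4) ord unfolding 1(1-3)
    by (elim insertE emptyE Pair_inject; hypsubst; simp only: turn.simps)
      (simp_all add: par swap_def del: atLeastAtMost_iff weight.simps rho1.simps rho2.simps,
       (elim disjE conjE; (hypsubst)?; simp add: par weightA_def weightB_def split: if_split)+)
qed

lemma two_cases:
  assumes "prec p q" "prec q (turn p)"
  obtains j x a k y b where "p = (j, x, a)" "q = (j + k, y, b)" "k = 0 \<or> k = 1 \<or> k = 2"
proof -
  obtain j x a k y b where e: "p = (j, x, a)" "q = (k, y, b)"
    by (metis prod_cases3)
  have "j \<le> k" "k \<le> j + 2"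
    using assms unfolding e turn.simps by (blast dest: block_le)+
  then have "k - j = 0 \<or> k - j = 1 \<or> k - j = 2" by arith
  then show ?thesis using e by (intro that[of j x a "k - j" y b]) auto
qed

text \<open>A diameter flip replaces one root triangle by another and interchanges the subtrees:
  \<open>e\<close>, \<open>f\<close> are the corrections of the left and right subtree before,
  \<open>g\<close>, \<open>h\<close> those of the same subtrees in reverse roles after.\<close>

lemma diameter_bound_even:
  assumes "prec p q" "prec q (turn p)" "even (fst p)"
    "e = 0 \<or> e = 1 \<and> kappa1 p q" "f = 0 \<or> f = -1 \<and> kappa2 q (turn p)"
    "g = 0 \<or> g = 1 \<and> kappa1 q (turn p)" "h = 0 \<or> h = -1 \<and> kappa2 (turn p) (turn q)"
  shows "weight q (turn p) (turn q) - weight p q (turn p) + g + h - e - f \<in> {-2..2}"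
  using assms(1-2)
proof (cases rule: two_cases)
  case (1 j x a k y b)
  have par: "even j" using assms(3) 1 by simp
  note ord = assms(1-2,4-7)[unfolded 1]
  show ?thesis using 1(3) ord unfolding 1(1-2)
    by (elim disjE[of "k = 0"] disjE[of "k = 1"]; hypsubst; simp only: turn.simps)
      (simp_all add: par del: atLeastAtMost_iff weight.simps rho1.simps rho2.simps,
       (elim disjE conjE; (hypsubst)?; simp add: par weightA_def weightB_def split: if_split)+)
qed

lemma diameter_bound_odd:
  assumes "prec p q" "prec q (turn p)" "odd (fst p)"
    "e = 0 \<or> e = 1 \<and> kappa1 p q" "f = 0 \<or> f = -1 \<and> kappa2 q (turn p)"
    "g = 0 \<or> g = 1 \<and> kappa1 q (turn p)" "h = 0 \<or> h = -1 \<and> kappa2 (turn p) (turn q)"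
  shows "weight q (turn p) (turn q) - weight p q (turn p) + g + h - e - f \<in> {-2..2}"
  using assms(1-2)
proof (cases rule: two_cases)
  case (1 j x a k y b)
  have par: "odd j" using assms(3) 1 by simp
  note ord = assms(1-2,4-7)[unfolded 1]
  show ?thesis using 1(3) ord unfolding 1(1-2)
    by (elim disjE[of "k = 0"] disjE[of "k = 1"]; hypsubst; simp only: turn.simps)
      (simp_all add: par del: atLeastAtMost_iff weight.simps rho1.simps rho2.simps,
       (elim disjE conjE; (hypsubst)?; simp add: par weightA_def weightB_def split: if_split)+)
qed

lemma top_bound:
  assumes "prec p q" "prec q r" "prec r (turn p)"
    "e = 0 \<or> e = 1 \<and> kappa1 p q" "f = 0 \<or> f = -1 \<and> kappa2 r (turn p)"
  shows "\<bar>swap p q r (turn p) + rho1 p q r + f - e - rho2 q r (turn p)\<bar> \<le> 2"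
  using top_bound_even[OF assms(1-3) _ assms(4,5)] top_bound_odd[OF assms(1-3) _ assms(4,5)]
  by (cases "even (fst p)") (auto simp: abs_le_iff)

lemma diameter_bound:
  assumes "prec p q" "prec q (turn p)"
    "e = 0 \<or> e = 1 \<and> kappa1 p q" "f = 0 \<or> f = -1 \<and> kappa2 q (turn p)"
    "g = 0 \<or> g = 1 \<and> kappa1 q (turn p)" "h = 0 \<or> h = -1 \<and> kappa2 (turn p) (turn q)"
  shows "\<bar>weight q (turn p) (turn q) - weight p q (turn p) + g + h - e - f\<bar> \<le> 2"
  using diameter_bound_even[OF assms(1,2) _ assms(3-6)] diameter_bound_odd[OF assms(1,2) _ assms(3-6)]
  by (cases "even (fst p)") (auto simp: abs_le_iff)

lemma weight_turn: "weight (turn p) (turn q) (turn r) = weight p q r"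
  by (cases p; cases q; cases r) simp

lemma rho1_turn: "rho1 (turn p) (turn q) (turn r) = rho1 p q r"
  by (cases p; cases q; cases r) simp

lemma rho2_turn: "rho2 (turn p) (turn q) (turn r) = rho2 p q r"
  by (cases p; cases q; cases r) (simp add: algebra_simps)

lemma div_mod_less:
  fixes m n k :: nat
  assumes "m < n" shows "m div k < n div k \<or> m div k = n div k \<and> m mod k < n mod k"
proof -
  have "m div k \<le> n div k" using assms by (simp add: div_le_mono)
  moreover have "m mod k < n mod k" if "m div k = n div k"
    using assms that div_mult_mod_eq[of m k] div_mult_mod_eq[of n k] by (metis add_less_cancel_left)
  ultimately show ?thesis by linarith
qed

section \<open>The potential of a tree and its change under a step\<close>

locale potential =
  fixes N H M :: nat
  assumes N_pos: "0 < N"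
begin

definition height :: "nat \<Rightarrow> nat" where
  "height i = (if i mod N < H then i mod N else N - 1 - i mod N)"

definition lab :: "nat \<Rightarrow> label" where
  "lab i = (2 * int (i div N) + (if i mod N < H then 0 else 1), int (height i div M), int (height i mod M))"

lemma lab_turn: "lab (i + N) = turn (lab i)"
  using N_pos unfolding lab_def height_def by simp

lemma lab_prec: assumes "i < j" shows "prec (lab i) (lab j)"
proof -
  have ge: "i div N \<le> j div N" using assms by (simp add: div_le_mono)
  show ?thesis
  proof (cases "i div N = j div N")
    case False
    then show ?thesis using ge unfolding lab_def by simp
  next
    case True
    have r: "i mod N < j mod N" using div_mod_less[OF assms, of N] True by simp
    have j: "j mod N < N" using N_pos by simp
    show ?thesis
    proof (cases "j mod N < H")
      case True
      then show ?thesis using r \<open>i div N = j div N\<close> div_mod_less[OF r, of M]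
        unfolding lab_def height_def by auto
    next
      case False
      have "N - 1 - j mod N < N - 1 - i mod N" using r j by linarith
      from div_mod_less[OF this, of M] show ?thesis using r \<open>i div N = j div N\<close> False
        unfolding lab_def height_def by auto
    qed
  qed
qed

lemma lab_prec_turn: "j < i + N \<Longrightarrow> prec (lab j) (turn (lab i))"
  using lab_prec[of j "i + N"] by (simp add: lab_turn)

fun psi :: "nat \<Rightarrow> tree \<Rightarrow> int" where
  "psi i Leaf = 0"
| "psi i (Node l r) =
    weight (lab i) (lab (i + leaves l)) (lab (i + leaves l + leaves r)) + psi i l + psi (i + leaves l) r"

fun sigma1 :: "nat \<Rightarrow> tree \<Rightarrow> int" where
  "sigma1 i Leaf = 0"
| "sigma1 i (Node l r) = rho1 (lab i) (lab (i + leaves l)) (lab (i + leaves l + leaves r))"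

fun sigma2 :: "nat \<Rightarrow> tree \<Rightarrow> int" where
  "sigma2 i Leaf = 0"
| "sigma2 i (Node l r) = rho2 (lab i) (lab (i + leaves l)) (lab (i + leaves l + leaves r))"

text \<open>The root triangle borders the diameter; the corrections sit on its two neighbours, the
  root triangles of \<open>l\<close> and \<open>r\<close>.\<close>

fun pot :: "nat \<times> tree \<Rightarrow> int" where
  "pot (i, Leaf) = 0"
| "pot (i, Node l r) = psi i (Node l r) + sigma1 i l + sigma2 (i + leaves l) r"

lemma psi_turn: "psi (i + N) t = psi i t"
proof (induction t arbitrary: i)
  case (Node l r)
  have *: "lab (i + N + n) = turn (lab (i + n))" for n using lab_turn[of "i + n"] by (simp add: add_ac)
  show ?case using Node.IH(1)[of i] Node.IH(2)[of "i + leaves l"] *[of 0] *[of "leaves l"] *[of "leaves l + leaves r"]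
    by (simp add: weight_turn add_ac)
qed simp

lemma sigma1_turn: "sigma1 (i + N) t = sigma1 i t"
proof (cases t)
  case (Node l r)
  have *: "lab (i + N + n) = turn (lab (i + n))" for n using lab_turn[of "i + n"] by (simp add: add_ac)
  show ?thesis using *[of 0] *[of "leaves l"] *[of "leaves l + leaves r"] Node
    by (simp add: rho1_turn add_ac)
qed simp

lemma sigma2_turn: "sigma2 (i + N) t = sigma2 i t"
proof (cases t)
  case (Node l r)
  have *: "lab (i + N + n) = turn (lab (i + n))" for n using lab_turn[of "i + n"] by (simp add: add_ac)
  show ?thesis using *[of 0] *[of "leaves l"] *[of "leaves l + leaves r"] Node
    by (simp add: rho2_turn add_ac)
qed simp

lemma pot_turn: "pot (i + N, t) = pot (i, t)"
proof (cases t)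
  case (Node l r)
  then show ?thesis
    using psi_turn[of i t] sigma1_turn[of i l] sigma2_turn[of "i + leaves l" r] by (simp add: add_ac)
qed simp

lemma sigma1_cases: "sigma1 i t = 0 \<or> sigma1 i t = 1 \<and> kappa1 (lab i) (lab (i + leaves t))"
proof (cases t)
  case (Node l r)
  have "prec (lab i) (lab (i + leaves l))" "prec (lab (i + leaves l)) (lab (i + leaves l + leaves r))"
    by (simp_all add: lab_prec)
  from rho1_cases[OF this] show ?thesis using Node by (simp add: add_ac)
qed simp

lemma sigma2_cases: "sigma2 i t = 0 \<or> sigma2 i t = -1 \<and> kappa2 (lab i) (lab (i + leaves t))"
proof (cases t)
  case (Node l r)
  have "prec (lab i) (lab (i + leaves l))" "prec (lab (i + leaves l)) (lab (i + leaves l + leaves r))"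
    by (simp_all add: lab_prec)
  from rho2_cases[OF this] show ?thesis using Node by (simp add: add_ac)
qed simp

lemma four_prec:
  assumes "leaves a + leaves b + leaves e < N"
  shows "prec (lab i) (lab (i + leaves a))" "prec (lab (i + leaves a)) (lab (i + leaves a + leaves b))"
    "prec (lab (i + leaves a + leaves b)) (lab (i + leaves a + leaves b + leaves e))"
    "prec (lab (i + leaves a + leaves b + leaves e)) (turn (lab i))"
  using assms by (auto intro!: lab_prec lab_prec_turn)

lemma psi_right:
  assumes "leaves a + leaves b + leaves e < N"
  shows "\<bar>psi i (Node (Node a b) e) - psi i (Node a (Node b e))\<bar> \<le> 2"
  using swap_bound[OF four_prec[OF assms, of i]] unfolding swap_def by (simp add: add_ac)

lemma sigma1_right:
  assumes "leaves a + leaves b + leaves e < N"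
  shows "\<bar>psi i (Node (Node a b) e) + sigma1 i (Node (Node a b) e)
    - (psi i (Node a (Node b e)) + sigma1 i (Node a (Node b e)))\<bar> \<le> 2"
  using swap_bound_rho1[OF four_prec[OF assms, of i]] unfolding swap_def by (simp add: add_ac)

lemma sigma2_right:
  assumes "leaves a + leaves b + leaves e < N"
  shows "\<bar>psi i (Node (Node a b) e) + sigma2 i (Node (Node a b) e)
    - (psi i (Node a (Node b e)) + sigma2 i (Node a (Node b e)))\<bar> \<le> 2"
  using swap_bound_rho2[OF four_prec[OF assms, of i]] unfolding swap_def by (simp add: add_ac)

lemma psi_rot: "rot t t' \<Longrightarrow> leaves t < N \<Longrightarrow> \<bar>psi i t - psi i t'\<bar> \<le> 2"
proof (induction arbitrary: i rule: rot.induct)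
  case (right a b e)
  then show ?case using psi_right[of a b e i] by (simp del: psi.simps)
next
  case (left a b e)
  then show ?case using psi_right[of a b e i] by (simp del: psi.simps)
next
  case (in_left l l' r)
  then show ?case using in_left.IH[of i] rot_leaves[OF in_left.hyps] by simp
next
  case (in_right r r' l)
  then show ?case using in_right.IH[of "i + leaves l"] rot_leaves[OF in_right.hyps] by simp
qed

text \<open>Only a rotation at the root of \<open>t\<close> alters the corrected triangle. A deeper
  one preserves leaf counts, hence all three vertices, and the plain bound \<open>psi_rot\<close>
  applies.\<close>

lemma sigma1_rot:
  assumes "rot t t'" "leaves t < N"
  shows "\<bar>psi i t + sigma1 i t - (psi i t' + sigma1 i t')\<bar> \<le> 2"
  using assms(1)
proof cases
  case (right a b e)
  then show ?thesis using sigma1_right[of a b e i] assms(2) by (simp del: psi.simps sigma1.simps)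
next
  case (left a b e)
  then show ?thesis using sigma1_right[of a b e i] assms(2) by (simp del: psi.simps sigma1.simps)
next
  case (in_left l l' r)
  then show ?thesis using psi_rot[OF in_left(3), of i] rot_leaves[OF in_left(3)] assms(2) by simp
next
  case (in_right r r' l)
  then show ?thesis using psi_rot[OF in_right(3), of "i + leaves l"] rot_leaves[OF in_right(3)] assms(2) by simp
qed

lemma sigma2_rot:
  assumes "rot t t'" "leaves t < N"
  shows "\<bar>psi i t + sigma2 i t - (psi i t' + sigma2 i t')\<bar> \<le> 2"
  using assms(1)
proof cases
  case (right a b e)
  then show ?thesis using sigma2_right[of a b e i] assms(2) by (simp del: psi.simps sigma2.simps)
next
  case (left a b e)
  then show ?thesis using sigma2_right[of a b e i] assms(2) by (simp del: psi.simps sigma2.simps)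
next
  case (in_left l l' r)
  then show ?thesis using psi_rot[OF in_left(3), of i] rot_leaves[OF in_left(3)] assms(2) by simp
next
  case (in_right r r' l)
  then show ?thesis using psi_rot[OF in_right(3), of "i + leaves l"] rot_leaves[OF in_right(3)] assms(2) by simp
qed

lemma top_right:
  assumes "leaves a + leaves b + leaves e = N"
  shows "\<bar>pot (i, Node (Node a b) e) - pot (i, Node a (Node b e))\<bar> \<le> 2"
proof -
  let ?p = "lab i" and ?q = "lab (i + leaves a)" and ?r = "lab (i + leaves a + leaves b)"
  have t: "lab (i + leaves a + leaves b + leaves e) = turn ?p"
    using lab_turn[of i] assms by (simp add: add_ac)
  have "prec ?p ?q" "prec ?q ?r" "prec ?r (turn ?p)"
    unfolding t[symmetric] by (simp_all add: lab_prec)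
  from top_bound[OF this sigma1_cases sigma2_cases[of "i + leaves a + leaves b" e, unfolded t]]
  show ?thesis unfolding swap_def using t by (simp add: add_ac)
qed

text \<open>Four situations: rotation at the root (\<open>top_bound\<close>), rotation inside the
  left or right subtree (bounds with one correction), and the diameter flip
  (\<open>diameter_bound\<close>).\<close>

lemma pot_step:
  assumes "step (i, t) s" "leaves t = N"
  shows "\<bar>pot s - pot (i, t)\<bar> \<le> 2"
  using assms(1)
proof cases
  case (rot t')
  note s = rot(1)
  from rot(2) show ?thesis
  proof cases
    case (right a b e)
    then show ?thesis using top_right[of a b e i] s assms(2) by (simp del: pot.simps)
  next
    case (left a b e)
    then show ?thesis using top_right[of a b e i] s assms(2) by (simp del: pot.simps)
  next
    case (in_left l l' r)
    have "leaves l < N" using assms(2)[unfolded in_left(1) leaves.simps] leaves_pos[of r] by linarith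
    from sigma1_rot[OF in_left(3) this, of i] show ?thesis
      using rot_leaves[OF in_left(3)] s in_left by (simp add: abs_le_iff)
  next
    case (in_right r r' l)
    have "leaves r < N" using assms(2)[unfolded in_right(1) leaves.simps] leaves_pos[of l] by linarith
    from sigma2_rot[OF in_right(3) this, of "i + leaves l"] show ?thesis
      using rot_leaves[OF in_right(3)] s in_right by (simp add: abs_le_iff)
  qed
next
  case (diameter l r)
  let ?p = "lab i" and ?q = "lab (i + leaves l)"
  have N: "leaves l + leaves r = N" using diameter assms(2) by simp
  have t: "lab (i + leaves l + leaves r) = turn ?p" "lab (i + leaves l + leaves r + leaves l) = turn ?q"
    using lab_turn[of i] lab_turn[of "i + leaves l"] N by (simp_all add: add_ac)
  have "prec ?p ?q" "prec ?q (turn ?p)" unfolding t[symmetric] by (simp_all add: lab_prec)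
  from diameter_bound[OF this sigma1_cases sigma2_cases[of "i + leaves l" r, unfolded t]
      sigma1_cases[of "i + leaves l" r, unfolded t] sigma2_cases[of "i + leaves l + leaves r" l, unfolded t]]
  have "\<bar>weight ?q (turn ?p) (turn ?q) - weight ?p ?q (turn ?p) + sigma1 (i + leaves l) r
    + sigma2 (i + leaves l + leaves r) l - sigma1 i l - sigma2 (i + leaves l) r\<bar> \<le> 2" .
  moreover have "psi (i + leaves l + leaves r) l = psi i l" using psi_turn[of i l] N by (simp add: add_ac)
  ultimately show ?thesis using diameter t by simp
qed

end

section \<open>The two zigzag triangulations\<close>

lemma edges_left: "(p, q) \<in> edges i l \<longleftrightarrow> (p, q) \<in> edges i (Node l r) \<and> q \<le> i + leaves l"
proof
  assume a: "(p, q) \<in> edges i (Node l r) \<and> q \<le> i + leaves l"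
  then consider "q = i + leaves l + leaves r" | "(p, q) \<in> edges i l" | "(p, q) \<in> edges (i + leaves l) r"
    by auto
  then show "(p, q) \<in> edges i l"
  proof cases
    case 1
    then show ?thesis using a leaves_pos[of r] by linarith
  next
    case 3
    then show ?thesis using a edges_bounds[OF 3] by linarith
  qed
qed (use edges_bounds[of p q i l] in simp)

lemma edges_right: "(p, q) \<in> edges (i + leaves l) r \<longleftrightarrow> (p, q) \<in> edges i (Node l r) \<and> i + leaves l \<le> p"
proof
  assume a: "(p, q) \<in> edges i (Node l r) \<and> i + leaves l \<le> p"
  then consider "p = i" | "(p, q) \<in> edges i l" | "(p, q) \<in> edges (i + leaves l) r"
    by auto
  then show "(p, q) \<in> edges (i + leaves l) r"
  proof cases
    case 1
    then show ?thesis using a leaves_pos[of l] by linarith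
  next
    case 2
    then show ?thesis using a edges_bounds[OF 2] by linarith
  qed
qed (use edges_bounds[of p q "i + leaves l" r] in simp)

text \<open>Two different apices over the same root edge would give crossing edges, so the root
  split is determined; edges of the subtrees are then told apart by their position relative to the
  apex.\<close>

lemma edges_inj: "edges i t = edges i t' \<Longrightarrow> leaves t = leaves t' \<Longrightarrow> t = t'"
proof (induction t arbitrary: i t')
  case Leaf
  then show ?case
  proof (cases t')
    case (Node l r)
    then show ?thesis using Leaf leaves_pos[of l] leaves_pos[of r] by (simp only: leaves.simps; linarith)
  qed simp
next
  case (Node l r)
  obtain l' r' where t': "t' = Node l' r'"
  proof (cases t')
    case Leaf
    then show ?thesis using Node.prems(2) leaves_pos[of l] leaves_pos[of r] by (simp only: leaves.simps; linarith)
  qed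
  have e: "edges i (Node l r) = edges i (Node l' r')" and n: "leaves l + leaves r = leaves l' + leaves r'"
    using Node.prems t' by simp_all
  have "(i, i + leaves l) \<in> edges i (Node l r)" "(i + leaves l, i + leaves l + leaves r) \<in> edges i (Node l r)"
    "(i, i + leaves l') \<in> edges i (Node l' r')" "(i + leaves l', i + leaves l' + leaves r') \<in> edges i (Node l' r')"
    using root_edge[of i l] root_edge[of "i + leaves l" r] root_edge[of i l'] root_edge[of "i + leaves l'" r'] by simp_all
  note m = this[folded e]
  have ll: "leaves l = leaves l'"
    using edges_noncrossing[OF m(1) m(4)] edges_noncrossing[OF m(3) m(2)] n
      leaves_pos[of l] leaves_pos[of r] leaves_pos[of l'] leaves_pos[of r'] by linarith
  have "(p, q) \<in> edges i l \<longleftrightarrow> (p, q) \<in> edges i l'" for p q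
    unfolding edges_left[of p q i l r] edges_left[of p q i l' r'] e ll ..
  then have "edges i l = edges i l'" by (intro set_eqI) (simp only: split_paired_all)
  moreover have "(p, q) \<in> edges (i + leaves l) r \<longleftrightarrow> (p, q) \<in> edges (i + leaves l') r'" for p q
  proof -
    have "(p, q) \<in> edges (i + leaves l) r \<longleftrightarrow> (p, q) \<in> edges i (Node l' r') \<and> i + leaves l' \<le> p"
      using edges_right[of p q i l r] unfolding e ll .
    then show ?thesis using edges_right[of p q i l' r'] by blast
  qed
  then have "edges (i + leaves l) r = edges (i + leaves l) r'"
    unfolding ll by (intro set_eqI) (simp only: split_paired_all)
  ultimately show ?case using Node.IH(1)[of i l'] Node.IH(2)[of "i + leaves l" r'] ll n t' by simp
qed

context polygon
begin

text \<open>The only edge of the opposite half with both ends in the closed arc is the diameter,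
  which is the root edge anyway.\<close>

lemma tri_edges:
  assumes "c < N" "leaves t = N"
  shows "edges c t = {(p, q). c \<le> p \<and> p < q \<and> q \<le> c + N \<and> {p, q} \<in> tri c t}"
proof (rule set_eqI, clarify)
  fix p q
  have "(p, q) \<in> edges c t" if pq: "c \<le> p" "p < q" "q \<le> c + N" "{p, q} \<in> tri c t"
  proof (cases "{p, q} \<in> half c t")
    case True
    then show ?thesis using half_iff[OF assms pq(2)] by simp
  next
    case False
    then have "{p, q} \<in> half (c + N) t" using pq(4) unfolding tri_def by blast
    then obtain r s where f: "{p, q} = {opp r, opp s}" "c \<le> r" "r < s" "s \<le> c + N"
      by (rule opp_halfE[OF assms])
    have "\<not> (c < opp r \<and> opp r < c + N)" "\<not> (c < opp s \<and> opp s < c + N)"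
      using opp_inside[OF assms] f by auto
    then have "\<not> (c < x \<and> x < c + N)" if "x \<in> {p, q}" for x using that unfolding f(1) by auto
    from this[of p] this[of q] pq have "p = c" "q = c + leaves t" using assms by auto
    then show ?thesis using root_edge[of c t] by simp
  qed
  moreover have "c \<le> p \<and> p < q \<and> q \<le> c + N \<and> {p, q} \<in> tri c t" if "(p, q) \<in> edges c t"
    using that edges_bounds[OF that] half_iff[OF assms, of p q] assms unfolding tri_def by auto
  ultimately show "(p, q) \<in> edges c t \<longleftrightarrow>
      (p, q) \<in> {(p, q). c \<le> p \<and> p < q \<and> q \<le> c + N \<and> {p, q} \<in> tri c t}" by blast
qed

lemma tri_diameter_unique:
  assumes "c < N" "leaves t = N" "c' < N" "leaves t' = N" "tri c t = tri c' t'"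
  shows "\<not> c < c'"
proof
  assume "c < c'"
  then have "crosses {c, c + N} {c', c' + N}" by (intro crossesI) (use assms(1,3) in simp_all)
  with tri_noncrossing[OF assms(1,2) diameter_in_tri[OF assms(1,2)] diameter_in_tri[OF assms(3,4), folded assms(5)]]
  show False by (rule notE)
qed

lemma tri_inj:
  assumes "c < N" "leaves t = N" "c' < N" "leaves t' = N" "tri c t = tri c' t'"
  shows "c = c' \<and> t = t'"
proof -
  have c: "c = c'"
    using tri_diameter_unique[OF assms] tri_diameter_unique[OF assms(3,4,1,2) assms(5)[symmetric]] by linarith
  have "edges c' t = edges c' t'"
    using tri_edges[OF assms(1,2)] tri_edges[OF assms(3,4), folded assms(5)] unfolding c by (simp only:)
  then have "t = t'" by (rule edges_inj) (simp only: assms(2,4))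
  with c show ?thesis by (rule conjI)
qed

end

context potential
begin

lemma pot_mod: "pot (i mod N, t) = pot (i, t)"
proof -
  have "pot (i mod N + k * N, t) = pot (i mod N, t)" for k
  proof (induction k)
    case (Suc k)
    have "i mod N + Suc k * N = i mod N + k * N + N" by simp
    then show ?case using pot_turn[of "i mod N + k * N" t] Suc by (simp only:)
  qed simp
  from this[of "i div N"] show ?thesis by simp
qed

end

locale labelled_polygon = polygon d N + potential N H M for d N H M :: nat
begin

text \<open>A path in the graph is followed by pairs (c, t), each flip contributing at most 2. The
  position is reduced modulo N before each step, which \<open>pot_mod\<close> makes
  harmless.\<close>

lemma path_lift:
  assumes "(tri c t, U) \<in> cyclohedron_graph d ^^ n" "leaves t = N"
  shows "\<exists>c' t'. U = tri c' t' \<and> leaves t' = N \<and> \<bar>pot (c', t') - pot (c, t)\<bar> \<le> 2 * int n"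
  using assms(1)
proof (induction n arbitrary: U)
  case 0
  then have "U = tri c t" by (elim relpow_0_E) (rule sym)
  then show ?case by (intro exI[of _ c] exI[of _ t] conjI assms(2)) simp_all
next
  case (Suc n)
  obtain V where V: "(tri c t, V) \<in> cyclohedron_graph d ^^ n" "(V, U) \<in> cyclohedron_graph d"
    by (rule relpow_Suc_E[OF Suc.prems])
  from Suc.IH[OF V(1)] obtain c' t' where 1: "V = tri c' t'" "leaves t' = N"
    "\<bar>pot (c', t') - pot (c, t)\<bar> \<le> 2 * int n" by blast
  have "flip d V U" using V(2) unfolding cyclohedron_graph_def by blast
  from flip_step[OF this[unfolded 1(1)] 1(2)] obtain c'' t''
    where 2: "step (c' mod N, t') (c'', t'')" "U = tri c'' t''" by blast
  have "\<bar>pot (c'', t'') - pot (c', t')\<bar> \<le> 2" using pot_step[OF 2(1) 1(2)] unfolding pot_mod .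
  then have "\<bar>pot (c'', t'') - pot (c, t)\<bar> \<le> 2 * int (Suc n)"
    using 1(3) abs_triangle_ineq[of "pot (c'', t'') - pot (c', t')" "pot (c', t') - pot (c, t)"] by simp
  moreover have "leaves t'' = N" using step_leaves[OF 2(1)] unfolding snd_conv 1(2) .
  ultimately show ?case using 2(2) by blast
qed

lemma path_bound:
  assumes "(tri c t, tri e s) \<in> cyclohedron_graph d ^^ n" "leaves t = N" "leaves s = N" "e < N"
  shows "pot (e, s) - pot (c, t) \<le> 2 * int n"
proof -
  from path_lift[OF assms(1,2)] obtain c' t' where 1: "tri e s = tri c' t'" "leaves t' = N"
    "\<bar>pot (c', t') - pot (c, t)\<bar> \<le> 2 * int n" by blast
  \<comment> \<open>The lifted path need not end at the prescribed pair, but at one representing the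
    same triangulation.\<close>
  have "e = c' mod N \<and> s = t'"
  proof (rule tri_inj)
    show "tri e s = tri (c' mod N) t'" unfolding tri_mod by (rule 1(1))
    show "c' mod N < N" using assms(4) by simp
  qed (rule assms 1)+
  then have "pot (e, s) = pot (c', t')" using pot_mod[of c' t'] by simp
  then show ?thesis using 1(3) by linarith
qed

end

section \<open>The potential of the zigzags\<close>

fun zz :: "nat \<Rightarrow> tree" where
  "zz 0 = Leaf"
| "zz (Suc 0) = Leaf"
| "zz (Suc (Suc 0)) = Node Leaf Leaf"
| "zz (Suc (Suc (Suc n))) = Node (Node Leaf (zz (Suc n))) Leaf"

lemma leaves_zz: "0 < n \<Longrightarrow> leaves (zz n) = n"
  by (induction n rule: zz.induct) auto

lemma abs_if_le: "\<bar>x\<bar> \<le> 3 \<Longrightarrow> \<bar>y\<bar> \<le> 3 \<Longrightarrow> \<bar>if P then x else y\<bar> \<le> (3::int)"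
  by simp

lemma weightA_bound: "\<bar>weightA k l x a y b z c\<bar> \<le> 3"
  unfolding weightA_def by (intro abs_if_le; simp)

lemma weightB_bound: "\<bar>weightB k l x a y b z c\<bar> \<le> 3"
  unfolding weightB_def by (intro abs_if_le; simp)

lemma weight_bound: "\<bar>weight p q r\<bar> \<le> 3"
  by (cases p; cases q; cases r) (simp add: weightA_bound weightB_bound)

text \<open>An exceptional index loses at most 11 = 5 + 6 against the value 5.\<close>

lemma sum_exceptions:
  fixes f :: "nat \<Rightarrow> int"
  assumes "finite B" "\<And>k. k < n \<Longrightarrow> k \<notin> B \<Longrightarrow> 5 \<le> f k" "\<And>k. -6 \<le> f k"
  shows "5 * int n - 11 * int (card B) \<le> (\<Sum>k<n. f k)"
proof -
  have "(\<Sum>k<n. if k \<in> B then -11 else 0) \<le> (\<Sum>k<n. f k - 5)"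
    by (rule sum_mono) (use assms(2,3) in \<open>auto simp: algebra_simps\<close>)
  moreover have "(\<Sum>k<n. if k \<in> B then -11 else 0) = -11 * int (card ({..<n} \<inter> B))"
    by (subst sum.inter_restrict[symmetric]) simp_all
  moreover have "card ({..<n} \<inter> B) \<le> card B" using assms(1) by (intro card_mono) auto
  ultimately show ?thesis by (simp add: sum_subtractf)
qed

lemma card_multiples:
  fixes g :: "nat \<Rightarrow> nat"
  assumes "inj_on g S" "\<And>k. k \<in> S \<Longrightarrow> g k mod M = 0 \<and> g k \<le> n"
  shows "card S \<le> n div M + 1"
proof -
  have "inj_on (\<lambda>k. g k div M) S"
  proof (rule inj_onI)
    fix k l assume "k \<in> S" "l \<in> S" "g k div M = g l div M"
    then have "g k = g l"
      using assms(2)[of k] assms(2)[of l] div_mult_mod_eq[of "g k" M] div_mult_mod_eq[of "g l" M] by simp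
    with assms(1) \<open>k \<in> S\<close> \<open>l \<in> S\<close> show "k = l" by (simp add: inj_on_eq_iff)
  qed
  moreover have "(\<lambda>k. g k div M) ` S \<subseteq> {..n div M}" using assms(2) by (auto intro: div_le_mono)
  ultimately show ?thesis using card_inj_on_le[of "\<lambda>k. g k div M" S "{..n div M}"] by simp
qed

context potential
begin

text \<open>The two triangles between the nested zigzag chords \<open>(i, i + n)\<close> and
  \<open>(i + 1, i + n - 1)\<close>.\<close>

definition level :: "nat \<Rightarrow> nat \<Rightarrow> int" where
  "level i n = weight (lab i) (lab (i + n - 1)) (lab (i + n)) + weight (lab i) (lab (i + 1)) (lab (i + n - 1))"

lemma level_bound: "\<bar>level i n\<bar> \<le> 6"
  using weight_bound[of "lab i" "lab (i + n - 1)" "lab (i + n)"] weight_bound[of "lab i" "lab (i + 1)" "lab (i + n - 1)"]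
  unfolding level_def by linarith

text \<open>The error 3 covers the single innermost triangle left over when n is even.\<close>

lemma psi_zz: "\<bar>psi i (zz n) - (\<Sum>k<(n - 1) div 2. level (i + k) (n - 2 * k))\<bar> \<le> 3"
proof (induction n arbitrary: i rule: zz.induct)
  case 3
  then show ?case using weight_bound by simp
next
  case (4 n)
  have n: "(Suc (Suc (Suc n)) - 1) div 2 = Suc ((Suc n - 1) div 2)" by simp
  have "(\<Sum>k<(Suc (Suc (Suc n)) - 1) div 2. level (i + k) (Suc (Suc (Suc n)) - 2 * k))
      = level i (Suc (Suc (Suc n))) + (\<Sum>k<(Suc n - 1) div 2. level (Suc i + k) (Suc n - 2 * k))"
    unfolding n sum.lessThan_Suc_shift by simp
  moreover have "psi i (zz (Suc (Suc (Suc n)))) = level i (Suc (Suc (Suc n))) + psi (Suc i) (zz (Suc n))"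
    unfolding level_def by (simp add: leaves_zz)
  ultimately show ?case using 4[of "Suc i"] by simp
qed simp_all

lemma pot_psi: "\<bar>pot (i, t) - psi i t\<bar> \<le> 2"
proof (cases t)
  case (Node l r)
  then show ?thesis using sigma1_cases[of i l] sigma2_cases[of "i + leaves l" r] by auto
qed simp

lemma pot_zz: "\<bar>pot (i, zz n) - (\<Sum>k<(n - 1) div 2. level (i + k) (n - 2 * k))\<bar> \<le> 5"
  using pot_psi[of i "zz n"] psi_zz[of i n] by linarith

lemma lab_first: "h < H \<Longrightarrow> H \<le> N \<Longrightarrow> lab h = (0, int (h div M), int (h mod M))"
  unfolding lab_def height_def by simp

lemma lab_second: "H + h < N \<Longrightarrow> lab (N - 1 - h) = (1, int (h div M), int (h mod M))"
  unfolding lab_def height_def by simp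

lemma lab_third: "h < H \<Longrightarrow> H \<le> N \<Longrightarrow> lab (N + h) = (2, int (h div M), int (h mod M))"
  using lab_turn[of h] lab_first[of h] by (simp add: add.commute)

text \<open>The two conditions modulo M put heights k - 1, k and k + 1 into one cell, so the level
  joins equal cells of blocks 0 and 1. The triangles have weights -3 and -2.\<close>

lemma level_zero:
  assumes "0 < M" "k + 1 < H" "H + k < N" "k mod M \<noteq> 0" "(k + 1) mod M \<noteq> 0"
  shows "level k (N - 2 * k) = -5"
proof -
  from assms(4) obtain h where k: "k = Suc h" by (cases k) auto
  have pos: "k + (N - 2 * k) = N - 1 - h" "N - 1 - h - 1 = N - 1 - k" using assms(2,3) k by auto
  have "lab (k + 1) = (0, int (k div M), int (k mod M) + 1)"
    using lab_first[of "Suc k"] assms by (simp add: div_Suc mod_Suc split: if_splits)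
  moreover have "lab (N - 1 - h) = (1, int (k div M), int (k mod M) - 1)"
    using lab_second[of h] assms(3,4) unfolding k by (simp add: div_Suc mod_Suc split: if_splits)
  moreover have "lab k = (0, int (k div M), int (k mod M))" "lab (N - 1 - k) = (1, int (k div M), int (k mod M))"
    using lab_first[of k] lab_second[of k] assms(2,3) by simp_all
  ultimately show ?thesis unfolding level_def pos by (simp add: weightA_def)
qed

text \<open>By N = 2c + M + 1 the chord starts at height c - k + M in block 1 and ends at height c -
  k in block 2: the same offset, one cell lower. The triangles have weights 2 and 3.\<close>

lemma level_shifted:
  assumes "0 < M" "N = 2 * c + M + 1" "H \<le> c + k" "k < c" "c < H" "H \<le> N" "(c - k) mod M \<noteq> 0"
  shows "level (c + k) (N - 2 * k) = 5"
proof -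
  from assms(4) obtain h where h: "c - k = Suc h" by (cases "c - k") auto
  have pos: "c + k + (N - 2 * k) - 1 = N + h" "c + k + (N - 2 * k) = N + Suc h"
    "c + k = N - 1 - (Suc h + M)" "c + k + 1 = N - 1 - (h + M)" using assms(2-6) h by auto
  have "lab (c + k) = (1, int (h div M) + 1, int (h mod M) + 1)"
    unfolding pos(3) using lab_second[of "Suc h + M"] assms h by (simp add: div_Suc mod_Suc split: if_splits)
  moreover have "lab (c + k + 1) = (1, int (h div M) + 1, int (h mod M))"
    unfolding pos(4) using lab_second[of "h + M"] assms h by simp
  moreover have "lab (N + Suc h) = (2, int (h div M), int (h mod M) + 1)"
    using lab_third[of "Suc h"] assms h by (simp add: div_Suc mod_Suc split: if_splits)
  moreover have "lab (N + h) = (2, int (h div M), int (h mod M))"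
    using lab_third[of h] assms h by simp
  ultimately show ?thesis unfolding level_def pos(1,2) by (simp add: weightB_def)
qed

lemma pot_difference:
  assumes M: "0 < M" and N: "N = 2 * c + M + 1" and H: "H = (N + 1) div 2"
  shows "5 * int N - 11 * int M - 33 * int (N div M) - 64 \<le> pot (c, zz N) - pot (0, zz N)"
proof -
  define K where "K = (N - 1) div 2"
  \<comment> \<open>Levels of the first zigzag that touch a cell border.\<close>
  define A where "A = {k \<in> {..<K}. k mod M = 0} \<union> {k \<in> {..<K}. (k + 1) mod M = 0}"
  \<comment> \<open>Exceptions of the second zigzag: levels starting before block 1, the innermost
    levels with k at least c, and cell borders. The first two kinds number at most M + 1
    together.\<close>
  define B where "B = {..<H - c} \<union> {c..<K} \<union> {k \<in> {..<c}. (c - k) mod M = 0}"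
  have KN: "K \<le> N" "int N - 2 \<le> 2 * int K" unfolding K_def by auto
  have cN: "c \<le> N" "c < H" "H \<le> N" using N H M by auto
  have "card {k \<in> {..<K}. k mod M = 0} \<le> N div M + 1"
    by (rule card_multiples[where g = "\<lambda>k. k"]) (use KN in \<open>auto simp: inj_on_def\<close>)
  moreover have "card {k \<in> {..<K}. (k + 1) mod M = 0} \<le> N div M + 1"
    by (rule card_multiples[where g = "\<lambda>k. k + 1"]) (use KN in \<open>auto simp: inj_on_def\<close>)
  ultimately have cA: "card A \<le> 2 * (N div M + 1)"
    unfolding A_def by (intro order_trans[OF card_Un_le]) simp
  have "card {k \<in> {..<c}. (c - k) mod M = 0} \<le> N div M + 1"
    by (rule card_multiples[where g = "\<lambda>k. c - k"]) (use cN in \<open>auto simp: inj_on_def\<close>)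
  moreover have "card ({..<H - c} \<union> {c..<K}) \<le> M + 1"
    by (rule order_trans[OF card_Un_le]) (use N H in \<open>simp add: K_def\<close>)
  ultimately have cB: "card B \<le> M + 1 + (N div M + 1)"
    unfolding B_def by (intro order_trans[OF card_Un_le]) simp
  have "5 * int K - 11 * int (card A) \<le> (\<Sum>k<K. - level (0 + k) (N - 2 * k))"
  proof (rule sum_exceptions)
    fix k assume "k < K" "k \<notin> A"
    then have "level k (N - 2 * k) = -5"
      by (intro level_zero[OF M]) (auto simp: A_def K_def H)
    then show "5 \<le> - level (0 + k) (N - 2 * k)" by simp
  qed (use level_bound in \<open>auto simp: A_def abs_le_iff\<close>)
  moreover have "5 * int K - 11 * int (card B) \<le> (\<Sum>k<K. level (c + k) (N - 2 * k))"
  proof (rule sum_exceptions)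
    fix k assume "k < K" "k \<notin> B"
    then have "level (c + k) (N - 2 * k) = 5"
      by (intro level_shifted[OF M N]) (use cN in \<open>auto simp: B_def\<close>)
    then show "5 \<le> level (c + k) (N - 2 * k)" by simp
  next
    show "-6 \<le> level (c + k) (N - 2 * k)" for k using level_bound[of "c + k" "N - 2 * k"] by linarith
  qed (simp add: B_def)
  moreover define D where "D = N div M"
  moreover have "int (card A) \<le> 2 * int D + 2" using cA unfolding D_def[symmetric] by simp
  moreover have "int (card B) \<le> int M + int D + 2" using cB unfolding D_def[symmetric] by simp
  \<comment> \<open>64 = 44 + 10 + 10: the constant parts 2 + 2 of the two exception counts times
    11, the loss in 10 K compared with 5 N, and the error 5 of \<open>pot_zz\<close> twice.\<close>
  ultimately show ?thesis
    using pot_zz[of 0 N, folded K_def] pot_zz[of c N, folded K_def] KN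
    unfolding sum_negf D_def[symmetric] by linarith
qed

end

section \<open>The limit\<close>

lemma graph_diameter_lower:
  assumes "u \<in> V" "v \<in> V" "\<And>n. (u, v) \<in> E ^^ n \<Longrightarrow> x \<le> real n"
  shows "ereal x \<le> ereal_of_enat (graph_diameter V E)"
proof -
  have "enat (nat \<lceil>x\<rceil>) \<le> graph_dist E u v"
    unfolding graph_dist_def
  proof (rule INF_greatest)
    fix n assume "n \<in> {n. (u, v) \<in> E ^^ n}"
    then have "x \<le> real n" using assms(3) by simp
    then show "enat (nat \<lceil>x\<rceil>) \<le> enat n" by (simp add: nat_le_iff ceiling_le_iff)
  qed
  also have "\<dots> \<le> (SUP v\<in>V. graph_dist E u v)" using assms(2) by (rule SUP_upper)
  also have "\<dots> \<le> graph_diameter V E" unfolding graph_diameter_def using assms(1) by (rule SUP_upper)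
  finally have "ereal_of_enat (enat (nat \<lceil>x\<rceil>)) \<le> ereal_of_enat (graph_diameter V E)"
    by (simp only: ereal_of_enat_le_iff)
  moreover have "ereal x \<le> ereal_of_enat (enat (nat \<lceil>x\<rceil>))" by (simp add: real_nat_ceiling_ge)
  ultimately show ?thesis by (rule order_trans[rotated])
qed

text \<open>\<open>s\<close> is the intended cell size. The actual size M is s or s + 1, whichever
  has the parity of d, so that d + 1 = 2c + M + 1 is solvable.\<close>

lemma cyclohedron_lower:
  assumes s: "0 < s" "s \<le> d"
  shows "ereal ((5 * (real d + 1) - 11 * (real s + 1) - 33 * ((real d + 1) / real s) - 64) / 2)
    \<le> ereal_of_enat (cyclohedron_diameter d)"
proof -
  define c where "c = (d - s) div 2"
  define M where "M = d - 2 * c"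
  have M: "0 < M" "s \<le> M" "M \<le> s + 1" "d + 1 = 2 * c + M + 1" using s unfolding M_def c_def by auto
  interpret labelled_polygon d "d + 1" "(d + 1 + 1) div 2" M by unfold_locales simp_all
  have z: "leaves (zz (d + 1)) = d + 1" by (rule leaves_zz) simp
  have c: "c < d + 1" unfolding c_def by simp
  have pos: "0 < d + 1" by simp
  have arith: "(5 * x - 11 * m' - 33 * q' - 64) / 2 \<le> y"
    if "q \<le> q'" "m \<le> m'" "5 * x - 11 * m - 33 * q - 64 \<le> 2 * y" for x m m' q q' y :: real
    using that by (simp add: field_simps)
  show ?thesis
    unfolding cyclohedron_diameter_def
  proof (rule graph_diameter_lower[OF tri_vertex[OF pos z] tri_vertex[OF c z]])
    fix n assume "(tri 0 (zz (d + 1)), tri c (zz (d + 1))) \<in> cyclohedron_graph d ^^ n"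
    from path_bound[OF this z z c] pot_difference[OF M(1,4) refl]
    have i: "5 * int (d + 1) - 11 * int M - 33 * int ((d + 1) div M) - 64 \<le> 2 * int n" by (rule order_trans[rotated])
    have "5 * (real d + 1) - 11 * real M - 33 * real ((d + 1) div M) - 64
        = real_of_int (5 * int (d + 1) - 11 * int M - 33 * int ((d + 1) div M) - 64)" by simp
    also have "\<dots> \<le> real_of_int (2 * int n)" using i by (simp only: of_int_le_iff)
    finally have r: "5 * (real d + 1) - 11 * real M - 33 * real ((d + 1) div M) - 64 \<le> 2 * real n" by simp
    have "real ((d + 1) div M) \<le> real (d + 1) / real M" by (rule of_nat_div_le_of_nat)
    also have "\<dots> \<le> real (d + 1) / real s" using s M by (intro divide_left_mono) simp_all
    finally have "real ((d + 1) div M) \<le> (real d + 1) / real s" by (simp add: add.commute)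
    moreover have "real M \<le> real s + 1" using M(3) by linarith
    ultimately show "(5 * (real d + 1) - 11 * (real s + 1) - 33 * ((real d + 1) / real s) - 64) / 2 \<le> real n"
      using r by (rule arith)
  qed
qed

lemma cyclohedron_upper:
  assumes "3 \<le> d" shows "ereal_of_enat (cyclohedron_diameter d) \<le> ereal (5 / 2 * (real d + 1))"
proof -
  interpret polygon d "d + 1" by unfold_locales simp
  have "cyclohedron_diameter d \<le> enat (2 * (d + 1) + (d + 1) div 2)"
    by (rule diameter_upper) (use assms in simp)
  then have "ereal_of_enat (cyclohedron_diameter d) \<le> ereal_of_enat (enat (2 * (d + 1) + (d + 1) div 2))"
    by (simp only: ereal_of_enat_le_iff)
  also have "\<dots> = ereal (real (2 * (d + 1) + (d + 1) div 2))" by simp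
  also have "\<dots> \<le> ereal (5 / 2 * (real d + 1))"
    using of_nat_div_le_of_nat[where 'a = real, of "d + 1" 2] by simp
  finally show ?thesis .
qed

theorem mainTheorem5:
  shows "(\<lambda>d. ereal_of_enat (cyclohedron_diameter d) / ereal (real d))
           \<longlonglongrightarrow> ereal (5 / 2)"
proof (rule tendsto_sandwich)
  \<comment> \<open>The floor s of sqrt d is replaced by sqrt d where it is subtracted and by sqrt d
    - 1 in the denominator; this leaves an explicit expression for the limit.\<close>
  let ?lower = "\<lambda>x::real. (5 * (x + 1) - 11 * (sqrt x + 1) - 33 * ((x + 1) / (sqrt x - 1)) - 64) / 2 / x"
  show "\<forall>\<^sub>F d in sequentially. ereal (?lower (real d)) \<le> ereal_of_enat (cyclohedron_diameter d) / ereal (real d)"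
    using eventually_ge_at_top[of 4]
  proof eventually_elim
    case (elim d)
    define s where "s = nat \<lfloor>sqrt (real d)\<rfloor>"
    have "sqrt 4 \<le> sqrt (real d)" using elim by (intro real_sqrt_le_mono) simp
    then have q: "2 \<le> sqrt (real d)" by simp
    have s: "real s \<le> sqrt (real d)" "sqrt (real d) - 1 < real s" using q unfolding s_def by linarith+
    have "sqrt (real d) * 1 \<le> sqrt (real d) * sqrt (real d)" by (rule mult_left_mono) (use q in linarith)+
    then have "real s \<le> real d" using s(1) by (simp only: mult_1_right real_sqrt_mult_self; simp)
    then have sd: "0 < s" "s \<le> d" using s q by simp_all
    have frac: "(real d + 1) / real s \<le> (real d + 1) / (sqrt (real d) - 1)"
      by (intro divide_left_mono mult_pos_pos) (use s q sd in simp_all)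
    have "ereal ((5 * (real d + 1) - 11 * (sqrt (real d) + 1) - 33 * ((real d + 1) / (sqrt (real d) - 1)) - 64) / 2)
        \<le> ereal ((5 * (real d + 1) - 11 * (real s + 1) - 33 * ((real d + 1) / real s) - 64) / 2)"
      unfolding ereal_less_eq
      by (intro divide_right_mono diff_mono mult_left_mono add_mono order_refl s(1) frac) simp_all
    also note cyclohedron_lower[OF sd]
    finally have "ereal ((5 * (real d + 1) - 11 * (sqrt (real d) + 1) - 33 * ((real d + 1) / (sqrt (real d) - 1)) - 64) / 2)
        / ereal (real d) \<le> ereal_of_enat (cyclohedron_diameter d) / ereal (real d)"
      by (rule ereal_divide_right_mono) (use elim in simp)
    then show ?case using elim by simp
  qed
  show "\<forall>\<^sub>F d in sequentially. ereal_of_enat (cyclohedron_diameter d) / ereal (real d) \<le> ereal (5 / 2 * (real d + 1) / real d)"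
    using eventually_ge_at_top[of 3]
  proof eventually_elim
    case (elim d)
    from ereal_divide_right_mono[OF cyclohedron_upper[OF elim], of "ereal (real d)"]
    show ?case using elim by simp
  qed
  show "(\<lambda>d. ereal (?lower (real d))) \<longlonglongrightarrow> ereal (5 / 2)"
    by (rule tendsto_ereal) real_asymp
  show "(\<lambda>d. ereal (5 / 2 * (real d + 1) / real d)) \<longlonglongrightarrow> ereal (5 / 2)"
    by (rule tendsto_ereal) real_asymp
qed

end
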